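(* There is a constant $C_{n,s,\theta}>0$, depending only on $n,s,\theta$, for which the following holds. Let $\mathbf{e}=\mathbf{e_1}=(1,0,\dots,0)$ and write $x=(x_1,x')\in\mathbb{R}\times\mathbb{R}^{n-1}$. Let $\Omega$ be an unbounded domain in $\mathbb{R}^n$ which is convex in the $x_1$-direction and symmetric about $\{x\in\mathbb{R}^n : x_1=0\}$. Let $0<s<1$, $f(x,u,\mathbf{p})\in\mathcal{F}$, and suppose that $u\in C^{1,1}_{loc}(\Omega)\cap C(\overline\Omega)\cap\mathcal{L}_s(\mathbb{R}^n)$ solves $$\begin{cases}-\mathbf{F_s}u(x)=f(x,u(x),\nabla u(x)) & \text{in }\Omega,\\ u>0 & \text{in }\Omega,\\ u\equiv 0 & \text{in }\mathbb{R}^n\setminus\Omega.\end{cases}$$ Assume that $f$ satisfies $$f(x_1,x',u,p_1,p_2,\dots,p_n)\le f(\bar x_1,x',u,-p_1,p_2,\dots,p_n)\qquad\text{for all } x_1\le 0,\ p_1\ge 0,\ x_1\le\bar x_1\le -x_1,$$ that for some $\beta>0$ and $C>0$ $$\frac{|f(x,u_1,\mathbf{p})-f(x,u_2,\mathbf{p})|}{|u_1-u_2|}\le C\left(|u_1|^\beta+|u_2|^\beta\right)\qquad\text{as } u_1,u_2\to 0$$ (i.e. for all $u_1\neq u_2$ sufficiently close to $0$, uniformly in $x$ and $\mathbf{p}$), and that $u$ satisfies the asymptotic property $$\limsup_{\substack{|x|\to\infty\\ x\in\Omega,\ x_1<0}}|x|^{2s}[u(x)]^\beta<\frac{C_{n,s,\theta}}{8C}.$$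 Then: (i) If there exists a line $\mathcal{L}$ parallel to the $x_1$-axis with $\mathcal{L}\cap\Omega\ne\emptyset$ and $\mathcal{L}\cap\Omega^c\neq\emptyset$, then $u(x_1,x')$ is strictly increasing in the left half of $\Omega$ (that is, $\Omega\cap\{x_1<0\}$) in the $x_1$-direction and $$u(x_1,x')\le u(-x_1,x')\qquad\forall\,x_1<0,\ (x_1,x')\in\Omega.$$ (ii) If any line $\mathcal{L}$ parallel to the $x_1$-axis with $\mathcal{L}\cap\Omega\ne\emptyset$ must satisfy $\mathcal{L}\cap\Omega^c=\emptyset$, then there exists $\mu_0\le 0$ such that $u(x_1,x')$ is strictly increasing in $\Omega\cap\{x_1<\mu_0\}$ in the $x_1$-direction, and $$\text{if }\mu_0=0:\quad u(x_1,x')\le u(-x_1,x')\quad\forall\,x_1<0,\ (x_1,x')\in\Omega,$$ $$\text{if }\mu_0<0:\quad u(x_1,x')=u(2\mu_0-x_1,x')\quad\forall\,x_1<\mu_0,\ (x_1,x')\in\Omega.$$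
   Context: Let $n\ge 2$ and $0<\theta\le\Theta<\infty$. For $0<s<1$, $\mathcal{L}_s(\mathbb{R}^n)$ is the set of functions $u:\mathbb{R}^n\to\mathbb{R}$ with $\int_{\mathbb{R}^n}\frac{|u(x)|}{1+|x|^{n+2s}}\,dx<+\infty$. $C^{1,1}_{loc}(\Omega)$ denotes functions that are $C^1$ with locally Lipschitz gradient in $\Omega$. For the unit vector $\mathbf{e}$ and $u\in\mathcal{L}_s(\mathbb{R}^n)$ that is $C^{1,1}$ near $x$, $$\mathbf{F_s}u(x):=\inf\left\{P.V.\int_{\mathbb{R}^n}\frac{u(y)-u(x)}{|A^{-1}(y-x)|^{n+2s}}\,dy \;:\; A \text{ a real symmetric } n\times n \text{ matrix},\ \theta I\le A\le\Theta I,\ \mathbf{e} \text{ is an eigenvector of } A\right\}.$$ A domain $\Omega$ is convex in the $x_1$-direction iff $(\bar x_1,x'),(x_1,x')\in\Omega$ imply $(t\bar x_1+(1-t)x_1,x')\in\Omega$ for any $0<t<1$. $\Omega^c:=\mathbb{R}^n\setminus\Omega$. $\mathcal{F}$ is the collection of functions $f(x,u,\mathbf{p}):\Omega\times\mathbb{R}\times\mathbb{R}^n\to\mathbb{R}$ which are locally Lipschitz in $u$, uniformly in $\mathbf{p}$ and locally uniformly in $x$: for any $M>0$ and any compact subset $K\subset\overline\Omega$ there exists $C_{K,M}>0$ such that for all $u_1,u_2\in[-M,M]$, all $x\in K$ and all $\mathbf{p}\in\mathbb{R}^n$, $|f(x,u_1,\mathbf{p})-f(x,u_2,\mathbf{p})|\le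 C_{K,M}|u_1-u_2|$ (for those $x$ at which $f$ is defined). *)

theory Defs
  imports "HOL-Analysis.Analysis"
begin

text \<open>
  Points of \<open>n\<close>-dimensional Euclidean space are vectors of type \<open>real ^ 'n\<close>, with
  \<open>n = CARD('n)\<close>. The distinguished first coordinate is an index \<open>k :: 'n\<close>: a point
  \<open>x = (x\<^sub>1, x')\<close> has \<open>x\<^sub>1 = x $ k\<close>, and \<open>x'\<close> consists of the remaining coordinates.
\<close>

definition set_coord :: "'n \<Rightarrow> real \<Rightarrow> real ^ 'n \<Rightarrow> real ^ 'n" where
  "set_coord k t x = (\<chi> i. if i = k then t else x $ i)"

definition reflect :: "'n \<Rightarrow> real \<Rightarrow> real ^ 'n \<Rightarrow> real ^ 'n" where
  "reflect k \<mu> x = set_coord k (2 * \<mu> - x $ k) x"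

definition grad :: "(real ^ 'n \<Rightarrow> real) \<Rightarrow> real ^ 'n \<Rightarrow> real ^ 'n" where
  "grad u x = (THE D. GDERIV u x :> D)"

definition C11_loc :: "(real ^ 'n) set \<Rightarrow> (real ^ 'n \<Rightarrow> real) set" where
  "C11_loc \<Omega> = {u. (\<forall>x\<in>\<Omega>. u differentiable (at x)) \<and> continuous_on \<Omega> (grad u) \<and>
     (\<forall>x\<in>\<Omega>. \<exists>r>0. \<exists>L. L-lipschitz_on (ball x r \<inter> \<Omega>) (grad u))}"

definition L_space :: "real \<Rightarrow> (real ^ 'n \<Rightarrow> real) set" where
  "L_space s = {u. u \<in> borel_measurable lebesgue \<and>
     integrable lebesgue (\<lambda>x. \<bar>u x\<bar> / (1 + norm x powr (real CARD('n) + 2 * s)))}"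

definition pv_integral :: "real ^ 'n \<Rightarrow> (real ^ 'n \<Rightarrow> real) \<Rightarrow> real" where
  "pv_integral x g = Lim (at_right 0) (\<lambda>\<epsilon>. LINT y:- ball x \<epsilon>|lebesgue. g y)"

definition loewner_le :: "real ^ 'n ^ 'n \<Rightarrow> real ^ 'n ^ 'n \<Rightarrow> bool" where
  "loewner_le A B \<longleftrightarrow> (\<forall>\<xi>. \<xi> \<bullet> (A *v \<xi>) \<le> \<xi> \<bullet> (B *v \<xi>))"

definition is_eigenvector :: "real ^ 'n ^ 'n \<Rightarrow> real ^ 'n \<Rightarrow> bool" where
  "is_eigenvector A v \<longleftrightarrow> v \<noteq> 0 \<and> (\<exists>c. A *v v = c *\<^sub>R v)"

text \<open>Here \<open>mat \<theta>\<close> is the scalar matrix \<open>\<theta> I\<close>.\<close>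

definition admissible :: "real \<Rightarrow> real \<Rightarrow> real ^ 'n \<Rightarrow> (real ^ 'n ^ 'n) set" where
  "admissible \<theta> \<Theta> e = {A. transpose A = A \<and> loewner_le (mat \<theta>) A \<and> loewner_le A (mat \<Theta>) \<and>
     is_eigenvector A e}"

text \<open>
  The limit in \<open>pv_integral\<close> exists, and the infimum is over a set of reals that is nonempty and
  bounded below, whenever \<open>u\<close> lies in \<open>L_space s\<close> and is \<open>C\<^sup>1\<^sup>,\<^sup>1\<close> near \<open>x\<close>
  (with \<open>0 < s < 1\<close>, \<open>0 < \<theta> \<le> \<Theta>\<close>, \<open>e \<noteq> 0\<close>); the operator is only meaningful there.
\<close>

definition Fs :: "real \<Rightarrow> real \<Rightarrow> real \<Rightarrow> real ^ 'n \<Rightarrow> (real ^ 'n \<Rightarrow> real) \<Rightarrow> real ^ 'n \<Rightarrow> real" where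
  "Fs s \<theta> \<Theta> e u x = (INF A \<in> admissible \<theta> \<Theta> e.
     pv_integral x (\<lambda>y. (u y - u x) / norm (matrix_inv A *v (y - x)) powr (real CARD('n) + 2 * s)))"

definition convex_in_dir :: "'n \<Rightarrow> (real ^ 'n) set \<Rightarrow> bool" where
  "convex_in_dir k \<Omega> \<longleftrightarrow> (\<forall>x\<in>\<Omega>. \<forall>y\<in>\<Omega>. (\<forall>i. i \<noteq> k \<longrightarrow> x $ i = y $ i) \<longrightarrow>
     (\<forall>t. 0 < t \<and> t < 1 \<longrightarrow> t *\<^sub>R y + (1 - t) *\<^sub>R x \<in> \<Omega>))"

definition line_in_dir :: "'n \<Rightarrow> (real ^ 'n) set \<Rightarrow> bool" where
  "line_in_dir k L \<longleftrightarrow> (\<exists>a. L = range (\<lambda>t. a + t *\<^sub>R axis k 1))"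

definition strict_incr_in_dir :: "'n \<Rightarrow> (real ^ 'n) set \<Rightarrow> (real ^ 'n \<Rightarrow> real) \<Rightarrow> bool" where
  "strict_incr_in_dir k D u \<longleftrightarrow>
     (\<forall>x\<in>D. \<forall>y\<in>D. (\<forall>i. i \<noteq> k \<longrightarrow> x $ i = y $ i) \<and> x $ k < y $ k \<longrightarrow> u x < u y)"

text \<open>
  A nonlinearity defined on \<open>\<Omega> \<times> \<real> \<times> \<real>\<^sup>n\<close> is represented by a total function whose values at
  points \<open>x\<close> outside \<open>\<Omega>\<close> are irrelevant; \<open>K\<close> may touch the boundary of \<open>\<Omega>\<close>, whence \<open>K \<inter> \<Omega>\<close>.
\<close>

definition nonlin_class ::
  "(real ^ 'n) set \<Rightarrow> (real ^ 'n \<Rightarrow> real \<Rightarrow> real ^ 'n \<Rightarrow> real) set" where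
  "nonlin_class \<Omega> = {f. \<forall>M>0. \<forall>K. compact K \<and> K \<subseteq> closure \<Omega> \<longrightarrow>
     (\<exists>C>0. \<forall>u1\<in>{-M..M}. \<forall>u2\<in>{-M..M}. \<forall>x\<in>K \<inter> \<Omega>. \<forall>p.
        \<bar>f x u1 p - f x u2 p\<bar> \<le> C * \<bar>u1 - u2\<bar>)}"

end

theory Submission
  imports Defs
begin

text \<open>
  Write \<open>w \<mu> x = u x\<^sup>\<mu> - u x\<close>, where \<open>x\<^sup>\<mu>\<close> is the reflection of \<open>x\<close> about \<open>x\<^sub>1 = \<mu>\<close>. Instead of
  minimising \<open>w \<mu>\<close> for one fixed \<open>\<mu>\<close>, minimise \<open>w \<mu> x\<close> over all \<open>\<mu> \<le> \<mu>\<^sub>1\<close> and \<open>x\<^sub>1 < \<mu>\<close> at once. By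
  decay a negative infimum is attained; there \<open>\<nabla>u(x\<^sup>\<mu>)\<close> is the reflection of \<open>\<nabla>u(x)\<close>, and minimality
  in \<open>\<mu>\<close> yields \<open>\<partial>\<^sub>1 u(x) \<ge> 0\<close>, so the structure condition on \<open>f\<close> applies and
  \<open>F u(x\<^sup>\<mu>) - F u(x) \<le> D |w \<mu> x|\<close> for a Lipschitz constant \<open>D\<close> of \<open>f\<close>. On the other hand, for every
  admissible \<open>A\<close> the difference of the two linear operators is the absolutely convergent integral of
  \<open>(w \<mu> y - w \<mu> x) / |A\<^sup>-\<^sup>1(y - x)|\<^sup>n\<^sup>+\<^sup>2\<^sup>s\<close>. Folding it over the plane bounds it from below by
  \<open>2 c\<^sub>0 |w \<mu> x| (\<mu> - x\<^sub>1)\<^sup>-\<^sup>2\<^sup>s\<close>, and by a positive constant wherever \<open>w \<mu>\<close> is positive on a fixed ball.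
  The first bound confines negative minima to a compact set and away from the plane; the second makes
  a plane with \<open>w \<mu> \<ge> 0\<close>, \<open>w \<mu> \<noteq> 0\<close> movable, and is the strong maximum principle.
\<close>

section \<open>Reflections and admissible kernels\<close>

lemma set_coord_nth [simp]: "set_coord k t x $ i = (if i = k then t else x $ i)"
  by (simp add: set_coord_def)

lemma reflect_nth [simp]: "reflect k \<mu> x $ i = (if i = k then 2 * \<mu> - x $ k else x $ i)"
  by (simp add: reflect_def)

lemma reflect_reflect [simp]: "reflect k \<mu> (reflect k \<mu> x) = x"
  by (simp add: vec_eq_iff)

lemma reflect_diff: "reflect k \<mu> x - reflect k \<mu> y = reflect k 0 (x - y)"
  by (simp add: vec_eq_iff)

lemma reflect_conv_axis: "reflect k \<mu> x = x + (2 * (\<mu> - x $ k)) *\<^sub>R axis k 1"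
  by (simp add: vec_eq_iff axis_def)

lemma inner_reflect: "reflect k 0 x \<bullet> reflect k 0 y = x \<bullet> y"
  by (simp add: inner_vec_def if_distrib cong: if_cong) (auto intro!: sum.cong)

lemma norm_reflect [simp]: "norm (reflect k 0 x) = norm x"
  by (simp add: norm_eq_sqrt_inner inner_reflect)

lemma dist_reflect [simp]: "dist (reflect k \<mu> x) (reflect k \<mu> y) = dist x y"
  by (simp add: dist_norm reflect_diff)

lemma linear_reflect: "linear (reflect k 0)"
  by (rule linearI) (simp_all add: vec_eq_iff algebra_simps)

lemma continuous_on_reflect [continuous_intros]:
  assumes "continuous_on S g" "continuous_on S h"
  shows "continuous_on S (\<lambda>x. reflect k (g x) (h x))"
  unfolding reflect_conv_axis by (intro continuous_intros assms)

lemma continuous_on_reflect1: "continuous_on S (reflect k \<mu>)"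
  by (intro continuous_intros)

lemma has_derivative_reflect: "(reflect k \<mu> has_derivative reflect k 0) F"
proof -
  have "((\<lambda>x. reflect k 0 x + (2 * \<mu>) *\<^sub>R axis k 1) has_derivative (\<lambda>h. reflect k 0 h + 0)) F"
    by (intro has_derivative_add has_derivative_const bounded_linear_imp_has_derivative
        linear_linear[THEN iffD2] linear_reflect)
  moreover have "(\<lambda>x. reflect k 0 x + (2 * \<mu>) *\<^sub>R axis k 1) = reflect k \<mu>"
    by (simp add: fun_eq_iff vec_eq_iff axis_def)
  ultimately show ?thesis by simp
qed

text \<open>A reflection is a diagonal affine map with entries 1 and -1, so the factor in the affine
  change of variables is 1.\<close>

lemma distr_lborel_reflect: "distr lborel borel (reflect k \<mu>) = (lborel :: (real^'n) measure)"
proof -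
  define c :: "real^'n \<Rightarrow> real" where "c j = (if j = axis k 1 then -1 else 1)" for j
  have T: "(2 * \<mu>) *\<^sub>R axis k 1 + (\<Sum>j\<in>Basis. (c j * (x \<bullet> j)) *\<^sub>R j) = reflect k \<mu> x" for x
  proof -
    have B: "(\<Sum>j\<in>Basis. (c j * (x \<bullet> j)) *\<^sub>R j) = (\<Sum>i\<in>UNIV. (c (axis i 1) * x $ i) *\<^sub>R axis i 1)"
    proof -
      have Basis: "(Basis :: (real^'n) set) = (\<lambda>i. axis i 1) ` UNIV"
        by (auto simp: Basis_vec_def)
      have inj: "inj (\<lambda>i::'n. axis i (1::real))"
        by (auto simp: inj_def axis_eq_axis)
      show ?thesis
        unfolding Basis by (subst sum.reindex[OF inj]) (simp add: inner_axis)
    qed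
    show ?thesis
      unfolding B
      by (auto simp: vec_eq_iff c_def axis_eq_axis axis_def if_distrib cong: if_cong)
  qed
  have "lborel = density (distr lborel borel (reflect k \<mu>)) (\<lambda>_. \<Prod>j\<in>Basis. \<bar>c j\<bar>)"
    using lborel_affine_euclidean[of c "(2 * \<mu>) *\<^sub>R axis k 1"] unfolding T by (simp add: c_def)
  moreover have "(\<Prod>j\<in>Basis. \<bar>c j\<bar>) = 1"
    by (rule prod.neutral) (auto simp: c_def)
  ultimately show ?thesis by (simp add: density_1)
qed

lemma
  fixes g :: "real^'n \<Rightarrow> real"
  assumes [measurable]: "g \<in> borel_measurable borel"
  shows integral_reflect: "(LINT y|lborel. g (reflect k \<mu> y)) = (LINT y|lborel. g y)"
    and integrable_reflect: "integrable lborel (\<lambda>y. g (reflect k \<mu> y)) \<longleftrightarrow> integrable lborel g"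
proof -
  have [measurable]: "reflect k \<mu> \<in> borel_measurable borel"
    by (intro borel_measurable_continuous_onI continuous_on_reflect1)
  show "(LINT y|lborel. g (reflect k \<mu> y)) = (LINT y|lborel. g y)"
    using integral_distr[of "reflect k \<mu>" lborel borel g] by (simp add: distr_lborel_reflect)
  show "integrable lborel (\<lambda>y. g (reflect k \<mu> y)) \<longleftrightarrow> integrable lborel g"
    using integrable_distr_eq[of "reflect k \<mu>" lborel borel g] by (simp add: distr_lborel_reflect)
qed

text \<open>Point reflection about \<open>x\<close> preserves Lebesgue measure, so the integral
  equals its own negative.\<close>

lemma integral_odd_about:
  fixes g :: "'a::euclidean_space \<Rightarrow> real"
  assumes [measurable]: "g \<in> borel_measurable borel" and odd: "\<And>y. g (2 *\<^sub>R x - y) = - g y"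
  shows "(LINT y|lborel. g y) = 0"
proof -
  have "distr lborel borel (\<lambda>y. 2 *\<^sub>R x - y) = (lborel :: 'a measure)"
    using lborel_affine[of "-1" "2 *\<^sub>R x"] by (simp add: density_1)
  then have "(LINT y|lborel. g (2 *\<^sub>R x - y)) = (LINT y|lborel. g y)"
    using integral_distr[of "\<lambda>y. 2 *\<^sub>R x - y" lborel borel g] by simp
  then show ?thesis by (simp add: odd)
qed

text \<open>
  What is needed of \<open>z \<mapsto> |A\<^sup>-\<^sup>1 z|\<close> for admissible \<open>A\<close>; here \<open>a\<close> is the eigenvalue for the direction \<open>k\<close>.
\<close>

definition kernel_norm :: "real \<Rightarrow> real \<Rightarrow> 'n \<Rightarrow> (real^'n \<Rightarrow> real) \<Rightarrow> bool" where
  "kernel_norm \<theta> \<Theta> k N \<longleftrightarrow> continuous_on UNIV N \<and> (\<forall>z. N (- z) = N z) \<and>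
     (\<forall>z. norm z / \<Theta> \<le> N z \<and> N z \<le> norm z / \<theta>) \<and>
     (\<exists>a\<in>{\<theta>..\<Theta>}. \<forall>z. (N z)\<^sup>2 = (z $ k / a)\<^sup>2 + (N (set_coord k 0 z))\<^sup>2)"

lemma mat_vector_mult: "mat c *v v = c *\<^sub>R v" for c :: real
  by (simp add: vec_eq_iff mat_def matrix_vector_mult_def if_distrib if_distribR cong: if_cong)

text \<open>The Loewner bounds become \<open>\<theta> * norm v \<le> norm (A *v v)\<close> and
  \<open>norm (A *v v) \<le> \<Theta> * norm v\<close>, which reverse for the inverse. The inverse
  is symmetric with the same eigenvector, so it respects the orthogonal splitting into the direction
  \<open>k\<close> and its complement.\<close>

lemma admissible_kernel_norm:
  fixes A :: "real^'n^'n"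
  assumes A: "A \<in> admissible \<theta> \<Theta> (axis k 1)" and \<theta>: "0 < \<theta>"
  shows "kernel_norm \<theta> \<Theta> k (\<lambda>z. norm (matrix_inv A *v z))"
proof -
  let ?e = "axis k 1 :: real^'n"
  have sym: "(A *v v) \<bullet> w = v \<bullet> (A *v w)" for v w
  proof -
    have "transpose A = A" using A by (simp add: admissible_def)
    then have "A *v v = v v* A" by (metis transpose_matrix_vector)
    then show ?thesis by (simp add: dot_lmul_matrix)
  qed
  have ge: "\<theta> * (v \<bullet> v) \<le> v \<bullet> (A *v v)" and le: "v \<bullet> (A *v v) \<le> \<Theta> * (v \<bullet> v)" for v
    using A by (auto simp: admissible_def loewner_le_def mat_vector_mult)
  obtain a where a: "A *v ?e = a *\<^sub>R ?e"
    using A by (auto simp: admissible_def is_eigenvector_def)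
  have a_bounds: "\<theta> \<le> a" "a \<le> \<Theta>"
    using ge[of ?e] le[of ?e] by (simp_all add: a inner_axis_axis)
  then have \<Theta>: "0 < \<Theta>" and "0 < a" using \<theta> by auto
  have lower: "\<theta> * norm v \<le> norm (A *v v)" for v
  proof (cases "v = 0")
    case False
    have "\<theta> * norm v * norm v \<le> v \<bullet> (A *v v)"
      using ge[of v] by (simp add: power2_norm_eq_inner[symmetric] power2_eq_square mult_ac)
    also have "\<dots> \<le> norm v * norm (A *v v)" by (rule norm_cauchy_schwarz)
    finally show ?thesis using False by (simp add: mult_ac)
  qed simp
  have upper: "norm (A *v v) \<le> \<Theta> * norm v" for v
  proof -
    \<comment> \<open>Polarisation replaces diagonalisation: expand the quadratic form at
      \<open>v + w\<close> and \<open>v - w\<close>, discard the second and use the parallelogram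
      inequality. Since \<open>A *v v\<close> is \<open>\<Theta>\<close> times \<open>w\<close>,
      this yields \<open>norm w \<le> norm v\<close>.\<close>
    define w where "w = (1 / \<Theta>) *\<^sub>R (A *v v)"
    have Av: "A *v v = \<Theta> *\<^sub>R w" using \<Theta> by (simp add: w_def)
    have "4 * (w \<bullet> (A *v v)) = (v + w) \<bullet> (A *v (v + w)) - (v - w) \<bullet> (A *v (v - w))"
      using sym[of v w]
      by (simp add: matrix_vector_right_distrib matrix_vector_mult_diff_distrib inner_add_left inner_add_right inner_diff_left inner_diff_right inner_commute)
    also have "\<dots> \<le> \<Theta> * ((v + w) \<bullet> (v + w)) + 0"
      using ge[of "v - w"] le[of "v + w"] \<theta> inner_ge_zero[of "v - w"]
      by (smt (verit) mult_nonneg_nonneg)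
    also have "\<dots> \<le> \<Theta> * (2 * (v \<bullet> v) + 2 * (w \<bullet> w))"
    proof -
      have "0 \<le> (v - w) \<bullet> (v - w)" by simp
      then have "(v + w) \<bullet> (v + w) \<le> 2 * (v \<bullet> v) + 2 * (w \<bullet> w)"
        by (simp add: inner_add_left inner_add_right inner_diff_left inner_diff_right inner_commute)
      then show ?thesis using \<Theta> by simp
    qed
    finally have "4 * (w \<bullet> w) \<le> 2 * (v \<bullet> v) + 2 * (w \<bullet> w)"
      using \<Theta> unfolding Av by (simp add: mult_ac)
    then have "norm w \<le> norm v"
      by (simp add: norm_le)
    then show ?thesis using \<Theta> by (simp add: Av)
  qed
  have "invertible A"
  proof -
    have "\<forall>v. A *v v = 0 \<longrightarrow> v = 0"
      using lower \<theta> by (metis mult_le_0_iff norm_le_zero_iff norm_zero not_le)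
    then show ?thesis
      using invertible_left_inverse matrix_left_invertible_ker by blast
  qed
  define M where "M = matrix_inv A"
  have AM: "A *v (M *v z) = z" and MA: "M *v (A *v z) = z" for z
    using someI_ex[OF \<open>invertible A\<close>[unfolded invertible_def]]
    unfolding M_def matrix_inv_def by (simp_all add: matrix_vector_mul_assoc)
  have Me: "M *v ?e = (1 / a) *\<^sub>R ?e"
  proof -
    have "M *v (A *v ((1 / a) *\<^sub>R ?e)) = M *v ?e"
      using \<open>0 < a\<close> by (simp add: a matrix_vector_mult_scaleR)
    then show ?thesis by (simp add: MA)
  qed
  have Msym: "(M *v v) \<bullet> w = v \<bullet> (M *v w)" for v w
    using sym[of "M *v v" "M *v w"] by (simp add: AM)
  have split: "(norm (M *v z))\<^sup>2 = (z $ k / a)\<^sup>2 + (norm (M *v set_coord k 0 z))\<^sup>2" for z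
  proof -
    have z: "z = set_coord k 0 z + (z $ k) *\<^sub>R ?e"
      by (simp add: vec_eq_iff axis_def)
    \<comment> \<open>By symmetry \<open>M\<close> moves onto the eigenvector, which is orthogonal
      to any vector with \<open>k\<close>-th coordinate 0; Pythagoras then splits the
      square.\<close>
    have "(M *v set_coord k 0 z) \<bullet> ?e = 0"
      unfolding Msym Me by (simp add: inner_axis)
    moreover have "M *v z = M *v set_coord k 0 z + (z $ k / a) *\<^sub>R ?e"
      by (subst z) (simp add: matrix_vector_right_distrib matrix_vector_mult_scaleR Me)
    ultimately show ?thesis
      unfolding power2_norm_eq_inner
      by (simp add: inner_add_left inner_add_right inner_commute inner_axis_axis power2_eq_square)
  qed
  show ?thesis
    unfolding kernel_norm_def M_def[symmetric]
  proof (intro conjI allI bexI[of _ a])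
    show "continuous_on UNIV (\<lambda>z. norm (M *v z))"
      by (intro continuous_intros linear_continuous_on) auto
    show "norm (M *v - z) = norm (M *v z)" for z
      by (metis matrix_vector_mult_diff_distrib diff_0 matrix_vector_mult_0_right norm_minus_cancel)
    show "norm z / \<Theta> \<le> norm (M *v z)" for z
      using upper[of "M *v z"] \<Theta> by (simp add: AM field_simps)
    show "norm (M *v z) \<le> norm z / \<theta>" for z
      using lower[of "M *v z"] \<theta> by (simp add: AM field_simps)
    show "(norm (M *v z))\<^sup>2 = (z $ k / a)\<^sup>2 + (norm (M *v set_coord k 0 z))\<^sup>2" for z
      by (rule split)
    show "a \<in> {\<theta>..\<Theta>}" using a_bounds by simp
  qed
qed

text \<open>Witness that the infimum in \<open>Fs\<close> is not over the empty set.\<close>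

lemma admissible_nonempty:
  assumes "\<theta> \<le> \<Theta>"
  shows "mat \<theta> \<in> admissible \<theta> \<Theta> (axis k 1)"
  using assms by (auto simp: admissible_def loewner_le_def is_eigenvector_def mat_vector_mult
      intro!: mult_right_mono)

lemma kernel_norm_measurable: "kernel_norm \<theta> \<Theta> k N \<Longrightarrow> N \<in> borel_measurable borel"
  by (simp add: kernel_norm_def borel_measurable_continuous_onI)

text \<open>The square of \<open>N z\<close> depends on \<open>z $ k\<close> only through its
  square.\<close>

lemma kernel_norm_reflect:
  assumes "kernel_norm \<theta> \<Theta> k N" "0 < \<theta>" "\<theta> \<le> \<Theta>"
  shows "N (reflect k 0 z) = N z"
proof -
  have nn: "0 \<le> N z" for z
    using assms by (smt (verit) kernel_norm_def divide_nonneg_nonneg norm_ge_zero)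
  have sc: "set_coord k 0 (reflect k 0 z) = set_coord k 0 z"
    by (simp add: vec_eq_iff)
  from assms obtain a where "\<And>z. (N z)\<^sup>2 = (z $ k / a)\<^sup>2 + (N (set_coord k 0 z))\<^sup>2"
    unfolding kernel_norm_def by blast
  from this[of z] this[of "reflect k 0 z"] have "(N (reflect k 0 z))\<^sup>2 = (N z)\<^sup>2"
    by (simp add: sc)
  then show ?thesis using nn by simp
qed

text \<open>The transverse parts cancel, leaving a difference of two squares along the axis that
  factors. This measures how much farther \<open>x\<close> is from the mirror image of
  \<open>y\<close> than from \<open>y\<close>.\<close>

lemma kernel_norm_reflect_diff:
  assumes N: "kernel_norm \<theta> \<Theta> k N" "0 < \<theta>" and x: "x $ k < \<mu>" and y: "y $ k < \<mu>"
  shows "4 * (\<mu> - x $ k) * (\<mu> - y $ k) / \<Theta>\<^sup>2 \<le> (N (reflect k \<mu> y - x))\<^sup>2 - (N (y - x))\<^sup>2"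
proof -
  from N obtain a where a: "\<theta> \<le> a" "a \<le> \<Theta>"
    and *: "\<And>z. (N z)\<^sup>2 = (z $ k / a)\<^sup>2 + (N (set_coord k 0 z))\<^sup>2"
    unfolding kernel_norm_def Bex_def atLeastAtMost_iff by blast
  have "set_coord k 0 (reflect k \<mu> y - x) = set_coord k 0 (y - x)"
    by (simp add: vec_eq_iff)
  then have "(N (reflect k \<mu> y - x))\<^sup>2 - (N (y - x))\<^sup>2
      = ((2 * \<mu> - y $ k - x $ k) / a)\<^sup>2 - ((y $ k - x $ k) / a)\<^sup>2"
    using *[of "reflect k \<mu> y - x"] *[of "y - x"] by simp
  also have "\<dots> = 4 * (\<mu> - x $ k) * (\<mu> - y $ k) / a\<^sup>2"
    by (simp add: power_divide diff_divide_distrib[symmetric]) (simp add: power2_eq_square algebra_simps)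
  also have "\<dots> \<ge> 4 * (\<mu> - x $ k) * (\<mu> - y $ k) / \<Theta>\<^sup>2"
    using a \<open>0 < \<theta>\<close> x y by (intro divide_left_mono power_mono mult_nonneg_nonneg mult_pos_pos zero_less_power) auto
  finally show ?thesis .
qed

section \<open>Integrability of the kernel\<close>

lemma ball_in_borel [measurable]: "ball x r \<in> sets borel"
  by simp

text \<open>\<open>g\<close> is dominated by the sum of the indicators of the balls with weights
  \<open>c j\<close>; its integral is the given series times the volume of the unit ball.\<close>

lemma integrable_ball_cover:
  fixes g :: "'a::euclidean_space \<Rightarrow> real"
  assumes [measurable]: "g \<in> borel_measurable borel"
    and nonneg: "\<And>z. 0 \<le> g z" and c: "\<And>j. 0 \<le> c j" and \<rho>: "\<And>j. 0 \<le> \<rho> j"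
    and sum: "summable (\<lambda>j::nat. c j * \<rho> j ^ DIM('a))"
    and cover: "\<And>z. g z \<noteq> 0 \<Longrightarrow> \<exists>j. norm z < \<rho> j \<and> g z \<le> c j"
  shows "integrable lborel g"
proof (rule integrableI_nonneg)
  let ?V = "unit_ball_vol (real DIM('a))"
  have "(\<integral>\<^sup>+ z. ennreal (g z) \<partial>lborel)
      \<le> (\<integral>\<^sup>+ (z::'a). (\<Sum>j. ennreal (c j) * indicator (ball 0 (\<rho> j)) z) \<partial>lborel)"
  proof (rule nn_integral_mono)
    fix z :: 'a
    show "ennreal (g z) \<le> (\<Sum>j. ennreal (c j) * indicator (ball 0 (\<rho> j)) z)"
    proof (cases "g z = 0")
      case False
      then obtain j where j: "norm z < \<rho> j" "g z \<le> c j" using cover by blast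
      have "ennreal (g z) \<le> (\<Sum>i\<in>{j}. ennreal (c i) * indicator (ball 0 (\<rho> i)) z)"
        using j by (simp add: ennreal_leI)
      also have "\<dots> \<le> (\<Sum>i. ennreal (c i) * indicator (ball 0 (\<rho> i)) z)"
        by (rule sum_le_suminf) auto
      finally show ?thesis .
    qed simp
  qed
  also have "\<dots> = (\<Sum>j. ennreal (c j) * emeasure lborel (ball (0::'a) (\<rho> j)))"
  proof (subst nn_integral_suminf)
    show "(\<lambda>z::'a. ennreal (c j) * indicator (ball 0 (\<rho> j)) z) \<in> borel_measurable lborel" for j
      by measurable
  qed (simp add: nn_integral_cmult_indicator)
  also have "\<dots> = (\<Sum>j. ennreal (?V * (c j * \<rho> j ^ DIM('a))))"
    using c \<rho> by (simp add: emeasure_ball ennreal_mult[symmetric] mult_ac)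
  also have "\<dots> = ennreal (\<Sum>j. ?V * (c j * \<rho> j ^ DIM('a)))"
    using c \<rho> sum by (intro suminf_ennreal2 summable_mult) auto
  also have "\<dots> < \<infinity>" by simp
  finally show "(\<integral>\<^sup>+ z. ennreal (g z) \<partial>lborel) < \<infinity>" .
qed (use nonneg in auto)

text \<open>On dyadic shells shrinking to 0 the contributions form a geometric series of ratio
  \<open>(1/2) powr (DIM('a) - p)\<close>, which is below 1.\<close>

lemma integrable_norm_powr_inside:
  fixes p r :: real
  assumes p: "0 \<le> p" "p < DIM('a)" and r: "0 < r"
  shows "integrable lborel (\<lambda>z::'a::euclidean_space. indicator (ball 0 r) z * norm z powr (- p))"
proof (rule integrable_ball_cover[where c = "\<lambda>j. (r / 2 ^ Suc j) powr (- p)" and \<rho> = "\<lambda>j. r / 2 ^ j"])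
  have "(r / 2 ^ Suc j) powr (- p) * (r / 2 ^ j) ^ DIM('a)
      = (r / 2) powr (- p) * r ^ DIM('a) * ((1/2) powr (DIM('a) - p)) ^ j" for j
  proof -
    have "(r / 2 ^ Suc j) powr (- p) = (r / 2) powr (- p) * ((1/2) ^ j) powr (- p)"
      using r by (simp add: powr_mult[symmetric] power_divide)
    also have "((1/2::real) ^ j) powr (- p) = ((1/2) powr (- p)) ^ j"
      by (simp add: powr_realpow[symmetric] powr_powr mult.commute)
    finally have 1: "(r / 2 ^ Suc j) powr (- p) = (r / 2) powr (- p) * ((1/2) powr (- p)) ^ j" .
    have 2: "(r / 2 ^ j) ^ DIM('a) = r ^ DIM('a) * ((1/2) ^ DIM('a)) ^ j"
      by (simp add: power_divide power_mult[symmetric] mult.commute)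
    have 3: "(1/2::real) powr (DIM('a) - p) = (1/2) powr (- p) * (1/2) ^ DIM('a)"
      by (simp add: powr_diff powr_realpow powr_minus divide_simps)
    show ?thesis
      unfolding 1 2 3 by (simp add: power_mult_distrib)
  qed
  moreover have "(1/2::real) powr (DIM('a) - p) < 1"
    using p powr01_less_one[of "1/2" "DIM('a) - p"] by simp
  ultimately show "summable (\<lambda>j. (r / 2 ^ Suc j) powr (- p) * (r / 2 ^ j) ^ DIM('a))"
    by (simp add: summable_geometric)
next
  fix z :: 'a assume "indicator (ball 0 r) z * norm z powr (- p) \<noteq> 0"
  then have z: "z \<noteq> 0" "norm z < r" by (auto simp: indicator_def split: if_splits)
  \<comment> \<open>The least such \<open>j\<close> locates the shell of \<open>z\<close>: its
    minimality supplies the upper bound \<open>norm z < r / 2 ^ j\<close>.\<close>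
  define P where "P j \<longleftrightarrow> r / 2 ^ Suc j \<le> norm z" for j
  have "\<exists>j. P j"
  proof -
    obtain j where "(1/2) ^ j < norm z / r"
      using real_arch_pow_inv[of "norm z / r" "1/2"] z r by auto
    then have "r / 2 ^ j < norm z" using r by (simp add: power_divide field_simps)
    moreover have "r / 2 ^ Suc j \<le> r / 2 ^ j" using r by (simp add: field_simps)
    ultimately show ?thesis unfolding P_def by (meson le_less_trans less_imp_le)
  qed
  then have L: "P (LEAST j. P j)" and N: "\<And>j. j < (LEAST j. P j) \<Longrightarrow> \<not> P j"
    by (auto intro: LeastI_ex dest: not_less_Least)
  define j where "j = (LEAST j. P j)"
  have "norm z < r / 2 ^ j"
  proof (cases j)
    case 0 then show ?thesis using z by simp
  next
    case (Suc i) then show ?thesis using N[of i] by (simp add: P_def j_def)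
  qed
  moreover have "norm z powr (- p) \<le> (r / 2 ^ Suc j) powr (- p)"
    using L p r by (intro powr_mono2') (auto simp: P_def j_def)
  ultimately show "\<exists>j. norm z < r / 2 ^ j \<and> indicator (ball 0 r) z * norm z powr (- p) \<le> (r / 2 ^ Suc j) powr (- p)"
    using z by (intro exI[of _ j]) simp
qed (use r in \<open>auto intro!: borel_measurable_times borel_measurable_indicator\<close>)

text \<open>The same shell argument going outwards, with ratio
  \<open>2 powr (DIM('a) - q)\<close>.\<close>

lemma integrable_norm_powr_outside:
  fixes q r :: real
  assumes q: "DIM('a) < q" and r: "0 < r"
  shows "integrable lborel (\<lambda>z::'a::euclidean_space. indicator (- ball 0 r) z * norm z powr (- q))"
proof (rule integrable_ball_cover[where c = "\<lambda>j. (r * 2 ^ j) powr (- q)" and \<rho> = "\<lambda>j. r * 2 ^ Suc j"])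
  have "(r * 2 ^ j) powr (- q) * (r * 2 ^ Suc j) ^ DIM('a)
      = r powr (- q) * (2 * r) ^ DIM('a) * (2 powr (DIM('a) - q)) ^ j" for j
  proof -
    have "(r * 2 ^ j) powr (- q) = r powr (- q) * (2 ^ j) powr (- q)"
      using r by (simp add: powr_mult)
    also have "((2::real) ^ j) powr (- q) = (2 powr (- q)) ^ j"
      by (simp add: powr_realpow[symmetric] powr_powr mult.commute)
    finally have 1: "(r * 2 ^ j) powr (- q) = r powr (- q) * (2 powr (- q)) ^ j" .
    have 2: "(r * 2 ^ Suc j) ^ DIM('a) = (2 * r) ^ DIM('a) * (2 ^ DIM('a)) ^ j"
      by (simp add: power_mult[symmetric] power_mult_distrib mult_ac)
    have 3: "(2::real) powr (DIM('a) - q) = 2 powr (- q) * 2 ^ DIM('a)"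
      by (simp add: powr_diff powr_realpow powr_minus divide_simps)
    show ?thesis
      unfolding 1 2 3 by (simp add: power_mult_distrib)
  qed
  moreover have "(2::real) powr (DIM('a) - q) < 1"
    using q by (simp add: powr_less_one)
  ultimately show "summable (\<lambda>j. (r * 2 ^ j) powr (- q) * (r * 2 ^ Suc j) ^ DIM('a))"
    by (simp add: summable_geometric)
next
  fix z :: 'a assume "indicator (- ball 0 r) z * norm z powr (- q) \<noteq> 0"
  then have z: "r \<le> norm z" by (auto simp: indicator_def split: if_splits)
  define P where "P j \<longleftrightarrow> norm z < r * 2 ^ Suc j" for j
  have "\<exists>j. P j"
  proof -
    obtain j where "norm z / r < 2 ^ j"
      using real_arch_pow[of 2 "norm z / r"] by auto
    then have "norm z < r * 2 ^ j" using r by (simp add: field_simps)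
    moreover have "r * 2 ^ j \<le> r * 2 ^ Suc j" using r by simp
    ultimately show ?thesis unfolding P_def by (meson less_le_trans)
  qed
  then have L: "P (LEAST j. P j)" and N: "\<And>j. j < (LEAST j. P j) \<Longrightarrow> \<not> P j"
    by (auto intro: LeastI_ex dest: not_less_Least)
  define j where "j = (LEAST j. P j)"
  have "r * 2 ^ j \<le> norm z"
  proof (cases j)
    case 0 then show ?thesis using z by simp
  next
    case (Suc i) then show ?thesis using N[of i] by (simp add: P_def j_def)
  qed
  then have "norm z powr (- q) \<le> (r * 2 ^ j) powr (- q)"
    using q r by (intro powr_mono2') auto
  then show "\<exists>j. norm z < r * 2 ^ Suc j \<and> indicator (- ball 0 r) z * norm z powr (- q) \<le> (r * 2 ^ j) powr (- q)"
    using z L by (intro exI[of _ j]) (simp add: P_def j_def)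
qed (use r in \<open>auto intro!: borel_measurable_times borel_measurable_indicator\<close>)

text \<open>Away from \<open>x\<close>, \<open>1 + norm y powr q\<close> is at most a constant times
  \<open>norm (y - x) powr q\<close>, so the weight of \<open>L_space\<close> dominates the
  kernel.\<close>

lemma L_space_integrable_kernel:
  fixes u :: "real^'n \<Rightarrow> real" and s :: real
  assumes u: "u \<in> L_space s" and [measurable]: "u \<in> borel_measurable borel"
    and s: "0 < s" and r: "0 < r"
  shows "integrable lborel (\<lambda>y. indicator (- ball x r) y * (\<bar>u y\<bar> / norm (y - x) powr (real CARD('n) + 2 * s)))"
proof -
  define q where "q = real CARD('n) + 2 * s"
  have q: "0 < q" using s by (simp add: q_def)
  \<comment> \<open>The first summand absorbs the 1 and the second absorbs
    \<open>norm y powr q\<close>, both by \<open>r \<le> norm (y - x)\<close>.\<close>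
  define \<kappa> where "\<kappa> = 1 / r powr q + (1 + norm x / r) powr q"
  have "integrable lborel (\<lambda>x. \<bar>u x\<bar> / (1 + norm x powr q))"
    using u unfolding L_space_def q_def[symmetric] by (simp add: integrable_completion)
  then have I: "integrable lborel (\<lambda>y. \<kappa> * (\<bar>u y\<bar> / (1 + norm y powr q)))"
    by (rule integrable_mult_right)
  have "norm (indicator (- ball x r) y * (\<bar>u y\<bar> / norm (y - x) powr q))
      \<le> norm (\<kappa> * (\<bar>u y\<bar> / (1 + norm y powr q)))" for y
  proof (cases "y \<in> ball x r")
    case False
    define d where "d = norm (y - x)"
    have d: "r \<le> d" using False by (simp add: d_def dist_norm norm_minus_commute)
    then have "0 < d" using r by simp
    have "norm y \<le> d + norm x" unfolding d_def by norm
    also have "norm x \<le> (norm x / r) * d"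
      using mult_right_mono[OF d, of "norm x"] r by (simp add: field_simps)
    finally have "norm y \<le> (1 + norm x / r) * d" by (simp add: algebra_simps)
    then have "norm y powr q \<le> ((1 + norm x / r) * d) powr q"
      using q by (intro powr_mono2) auto
    also have "\<dots> = (1 + norm x / r) powr q * d powr q"
      using r d by (simp add: powr_mult)
    finally have 1: "norm y powr q \<le> (1 + norm x / r) powr q * d powr q" .
    have "r powr q \<le> d powr q" using d r q by (intro powr_mono2) auto
    then have 2: "1 \<le> (1 / r powr q) * d powr q" using r by simp
    from 1 2 have "1 + norm y powr q \<le> \<kappa> * d powr q"
      by (simp add: \<kappa>_def algebra_simps)
    then have "1 / d powr q \<le> \<kappa> / (1 + norm y powr q)"
      using \<open>0 < d\<close> by (simp add: field_simps add_pos_nonneg)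
    then have "\<bar>u y\<bar> * (1 / d powr q) \<le> \<bar>u y\<bar> * (\<kappa> / (1 + norm y powr q))"
      by (rule mult_left_mono) simp
    moreover have "0 \<le> \<kappa>" using r by (simp add: \<kappa>_def)
    ultimately show ?thesis using False by (simp add: d_def mult_ac abs_mult)
  qed simp
  then show ?thesis
    unfolding q_def[symmetric] by (intro Bochner_Integration.integrable_bound[OF I]) auto
qed

lemma integrable_shift:
  fixes g :: "'a::euclidean_space \<Rightarrow> real"
  assumes "integrable lborel g"
  shows "integrable lborel (\<lambda>y. g (y - x))"
proof -
  have [measurable]: "g \<in> borel_measurable borel" using assms by auto
  have "distr lborel borel (\<lambda>y. - x + y) = (lborel :: 'a measure)"
    by (rule lborel_distr_plus)
  then show ?thesis
    using integrable_distr_eq[of "\<lambda>y. - x + y" lborel borel g] assms by simp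
qed

text \<open>Inside the ball the quadratic bound lowers the exponent to \<open>q - 2\<close>, below
  the dimension since \<open>s < 1\<close>. Outside, the constant \<open>u x\<close> meets the
  exponent \<open>q\<close>, above the dimension, and \<open>u y\<close> is controlled by
  \<open>L_space\<close>. \<open>F1\<close>, \<open>F2\<close> and \<open>F3\<close> are these three
  majorants.\<close>

lemma integrable_kernel_remainder:
  fixes u :: "real^'n \<Rightarrow> real" and s :: real
  assumes u: "u \<in> L_space s" and [measurable]: "u \<in> borel_measurable borel"
    and s: "0 < s" "s < 1" and n: "CARD('n) \<ge> 2" and r: "0 < r"
    and C11: "\<And>y. y \<in> ball x r \<Longrightarrow> \<bar>u y - u x - (y - x) \<bullet> v\<bar> \<le> L * (norm (y - x))\<^sup>2"
  shows "integrable lborel (\<lambda>y. (u y - u x - indicator (ball x r) y * ((y - x) \<bullet> v))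
           / norm (y - x) powr (real CARD('n) + 2 * s))"
proof -
  define q where "q = real CARD('n) + 2 * s"
  have q: "0 < q" using s by (simp add: q_def)
  define F1 where "F1 z = indicator (ball 0 r) z * norm z powr (- (q - 2))" for z :: "real^'n"
  define F2 where "F2 z = indicator (- ball 0 r) z * norm z powr (- q)" for z :: "real^'n"
  define F3 where "F3 y = indicator (- ball x r) y * (\<bar>u y\<bar> / norm (y - x) powr q)" for y
  define G where "G y = \<bar>L\<bar> * F1 (y - x) + \<bar>u x\<bar> * F2 (y - x) + F3 y" for y
  have "integrable lborel F1" "integrable lborel F2" "integrable lborel F3"
    unfolding F1_def F2_def F3_def q_def
    using n s r u by (intro integrable_norm_powr_inside integrable_norm_powr_outside
        L_space_integrable_kernel; simp)+
  then have I: "integrable lborel G"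
    unfolding G_def by (intro Bochner_Integration.integrable_add integrable_mult_right integrable_shift)
  have F_nonneg: "0 \<le> F1 z" "0 \<le> F2 z" "0 \<le> F3 z" for z
    by (auto simp: F1_def F2_def F3_def)
  have "norm ((u y - u x - indicator (ball x r) y * ((y - x) \<bullet> v)) / norm (y - x) powr q) \<le> norm (G y)" for y
  proof (cases "y \<in> ball x r")
    case True
    show ?thesis
    proof (cases "y = x")
      case False
      define d where "d = norm (y - x)"
      have "0 < d" using False by (simp add: d_def)
      have "L * d\<^sup>2 \<le> \<bar>L\<bar> * d\<^sup>2" by (intro mult_right_mono) auto
      then have "\<bar>u y - u x - (y - x) \<bullet> v\<bar> / d powr q \<le> \<bar>L\<bar> * d\<^sup>2 / d powr q"
        using C11[OF True] by (intro divide_right_mono) (auto simp: d_def)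
      also have "\<dots> = \<bar>L\<bar> * d powr (- (q - 2))"
        using \<open>0 < d\<close> by (simp add: powr_diff)
      finally have "\<bar>u y - u x - (y - x) \<bullet> v\<bar> / d powr q \<le> \<bar>L\<bar> * F1 (y - x)"
        using True by (simp add: F1_def d_def dist_norm norm_minus_commute)
      moreover have "0 \<le> \<bar>u x\<bar> * F2 (y - x)" by (intro mult_nonneg_nonneg F_nonneg abs_ge_zero)
      ultimately have "\<bar>u y - u x - (y - x) \<bullet> v\<bar> / d powr q \<le> \<bar>G y\<bar>"
        unfolding G_def using F_nonneg(3)[of y] by linarith
      then show ?thesis using True by (simp add: d_def)
    qed simp
  next
    case False
    have "\<bar>u y - u x\<bar> / norm (y - x) powr q \<le> \<bar>u x\<bar> * F2 (y - x) + F3 y"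
      using False divide_right_mono[OF abs_triangle_ineq4[of "u y" "u x"], of "norm (y - x) powr q"]
      by (simp add: F2_def F3_def dist_norm norm_minus_commute powr_minus divide_inverse[symmetric]
          add_divide_distrib add.commute)
    moreover have "0 \<le> \<bar>L\<bar> * F1 (y - x)" by (intro mult_nonneg_nonneg F_nonneg abs_ge_zero)
    ultimately have "\<bar>u y - u x\<bar> / norm (y - x) powr q \<le> \<bar>G y\<bar>"
      unfolding G_def by linarith
    then show ?thesis using False by simp
  qed
  moreover have "(\<lambda>y. (u y - u x - indicator (ball x r) y * ((y - x) \<bullet> v)) / norm (y - x) powr q)
      \<in> borel_measurable lborel"
    by measurable
  ultimately show ?thesis
    unfolding q_def[symmetric] by (intro Bochner_Integration.integrable_bound[OF I]) auto
qed

section \<open>The principal value as a convergent integral\<close>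

text \<open>The lower bound for \<open>N\<close>, inverted. At \<open>z = 0\<close> both sides are
  0, as division by 0 yields 0.\<close>

lemma kernel_powr_le:
  assumes "kernel_norm \<theta> \<Theta> k N" "0 < \<Theta>" "0 \<le> q"
  shows "1 / N z powr q \<le> \<Theta> powr q / norm z powr q"
proof (cases "z = 0")
  case True
  with assms have "N z = 0" by (auto simp: kernel_norm_def dest!: spec[of _ 0])
  then show ?thesis by simp
next
  case False
  have 1: "norm z / \<Theta> \<le> N z" using assms by (simp add: kernel_norm_def)
  have 2: "0 < norm z / \<Theta>" using False assms by simp
  have "(norm z / \<Theta>) powr q \<le> N z powr q"
    using 1 2 assms by (intro powr_mono2) auto
  then have "1 / N z powr q \<le> 1 / (norm z / \<Theta>) powr q"
    using 1 2 by (intro divide_left_mono mult_pos_pos) auto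
  then show ?thesis using False assms by (simp add: powr_divide)
qed

context
  fixes u N :: "real^'n \<Rightarrow> real" and q s r \<theta> \<Theta> L :: real and x v :: "real^'n" and k
  assumes u: "u \<in> L_space s" and u_borel [measurable]: "u \<in> borel_measurable borel"
    and s: "0 < s" "s < 1" and n: "CARD('n) \<ge> 2" and r: "0 < r"
    and C11: "\<And>y. y \<in> ball x r \<Longrightarrow> \<bar>u y - u x - (y - x) \<bullet> v\<bar> \<le> L * (norm (y - x))\<^sup>2"
    and N: "kernel_norm \<theta> \<Theta> k N" and \<theta>: "0 < \<theta>" "\<theta> \<le> \<Theta>"
    and q_def: "q = real CARD('n) + 2 * s"
begin

text \<open>The linear term is subtracted only near \<open>x\<close>, where it cancels the
  first-order singularity; far out it need not be integrable against the kernel.\<close>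

private definition "T y = u y - u x - indicator (ball x r) y * ((y - x) \<bullet> v)"

private lemma [measurable]: "N \<in> borel_measurable borel"
  using N by (rule kernel_norm_measurable)

private lemma [measurable]: "T \<in> borel_measurable borel"
  unfolding T_def by measurable

private lemma q_pos: "0 < q"
  using s by (simp add: q_def)

private lemma T_le: "\<bar>T y / N (y - x) powr q\<bar> \<le> \<Theta> powr q * \<bar>T y / norm (y - x) powr q\<bar>"
  using mult_left_mono[OF kernel_powr_le[OF N, of q "y - x"], of "\<bar>T y\<bar>"] \<theta> q_pos
  by (simp add: abs_mult mult_ac)

private lemma integrable_T0: "integrable lborel (\<lambda>y. T y / norm (y - x) powr q)"
  unfolding T_def q_def by (rule integrable_kernel_remainder[OF u u_borel s n r C11])

private lemma integrable_T: "integrable lborel (\<lambda>y. T y / N (y - x) powr q)"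
proof (rule Bochner_Integration.integrable_bound)
  show "integrable lborel (\<lambda>y. \<Theta> powr q * \<bar>T y / norm (y - x) powr q\<bar>)"
    using integrable_T0 by (intro integrable_mult_right integrable_abs)
qed (use T_le in \<open>auto simp: abs_mult\<close>)

lemma integrable_kernel:
  "integrable lborel (\<lambda>y. (u y - u x - indicator (ball x r) y * ((y - x) \<bullet> v))
     / N (y - x) powr q)"
  using integrable_T unfolding T_def .

text \<open>The right-hand side does not mention \<open>N\<close>, so it bounds the principal values
  for all admissible matrices at once and makes the infimum in \<open>Fs\<close> one over a set
  bounded below.\<close>

lemma integral_kernel_bound:
  "\<bar>LINT y|lborel. (u y - u x - indicator (ball x r) y * ((y - x) \<bullet> v))
      / N (y - x) powr q\<bar>
   \<le> \<Theta> powr q *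
      (LINT y|lborel. \<bar>(u y - u x - indicator (ball x r) y * ((y - x) \<bullet> v))
         / norm (y - x) powr q\<bar>)"
proof -
  have "\<bar>LINT y|lborel. T y / N (y - x) powr q\<bar> \<le> (LINT y|lborel. \<bar>T y / N (y - x) powr q\<bar>)"
    by (rule integral_abs_bound)
  also have "\<dots> \<le> (LINT y|lborel. \<Theta> powr q * \<bar>T y / norm (y - x) powr q\<bar>)"
    using integrable_T integrable_T0 T_le
    by (intro integral_mono integrable_abs integrable_mult_right) auto
  finally show ?thesis
    unfolding T_def by (simp only: Bochner_Integration.integral_mult_right_zero)
qed

text \<open>
  The gradient term is odd about \<open>x\<close>, so it does not contribute to the truncated integrals; what
  is left is absolutely integrable.
\<close>

lemma pv_integral_kernel:
  "pv_integral x (\<lambda>y. (u y - u x) / N (y - x) powr q)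
   = (LINT y|lborel. (u y - u x - indicator (ball x r) y * ((y - x) \<bullet> v))
        / N (y - x) powr q)"
proof -
  define I where "I \<epsilon> = (LINT y|lborel. indicator (- ball x \<epsilon>) y * (T y / N (y - x) powr q))" for \<epsilon>
  have truncated: "(LINT y:- ball x \<epsilon>|lebesgue. (u y - u x) / N (y - x) powr q) = I \<epsilon>"
    if \<epsilon>: "0 < \<epsilon>" "\<epsilon> < r" for \<epsilon>
  proof -
    \<comment> \<open>The gradient term on the annulus between the radii \<open>\<epsilon>\<close>
      and \<open>r\<close>. It is bounded with bounded support, hence integrable, and odd about
      \<open>x\<close>.\<close>
    define G where "G y = indicator (ball x r - ball x \<epsilon>) y * ((y - x) \<bullet> v) / N (y - x) powr q" for y
    have [measurable]: "G \<in> borel_measurable borel"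
      unfolding G_def by measurable
    have "(LINT y:- ball x \<epsilon>|lebesgue. (u y - u x) / N (y - x) powr q)
        = (LINT y|lborel. indicator (- ball x \<epsilon>) y *\<^sub>R ((u y - u x) / N (y - x) powr q))"
      unfolding set_lebesgue_integral_def by (rule integral_completion) measurable
    also have "\<dots> = (LINT y|lborel. indicator (- ball x \<epsilon>) y * (T y / N (y - x) powr q) + G y)"
    proof (rule Bochner_Integration.integral_cong)
      fix y
      have "ball x \<epsilon> \<subseteq> ball x r" using \<epsilon> by auto
      then show "indicator (- ball x \<epsilon>) y *\<^sub>R ((u y - u x) / N (y - x) powr q)
          = indicator (- ball x \<epsilon>) y * (T y / N (y - x) powr q) + G y"
        by (cases "y \<in> ball x \<epsilon>"; cases "y \<in> ball x r")
          (auto simp: T_def G_def diff_divide_distrib simp del: mem_ball)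
    qed simp
    also have "\<dots> = I \<epsilon> + (LINT y|lborel. G y)"
      unfolding I_def
    proof (rule Bochner_Integration.integral_add)
      show "integrable lborel (\<lambda>y. indicator (- ball x \<epsilon>) y * (T y / N (y - x) powr q))"
        using integrable_T by (rule Bochner_Integration.integrable_bound) (auto simp: indicator_def)
      show "integrable lborel G"
      proof (rule Bochner_Integration.integrable_bound)
        show "integrable lborel (\<lambda>y. r * norm v * (\<Theta> powr q / \<epsilon> powr q) * indicator (ball x r) y)"
          using r by (intro integrable_mult_right integrable_real_indicator) (auto simp: emeasure_ball)
        have "norm (G y) \<le> norm (r * norm v * (\<Theta> powr q / \<epsilon> powr q) * indicator (ball x r) y)" for y
        proof (cases "y \<in> ball x r - ball x \<epsilon>")
          case True
          then have y: "\<epsilon> \<le> norm (y - x)" "norm (y - x) \<le> r"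
            by (auto simp: dist_norm norm_minus_commute)
          have "\<bar>(y - x) \<bullet> v\<bar> \<le> r * norm v"
            using Cauchy_Schwarz_ineq2[of "y - x" v] y mult_right_mono[of _ _ "norm v"]
            by (meson norm_ge_zero order_trans)
          moreover have "1 / N (y - x) powr q \<le> \<Theta> powr q / \<epsilon> powr q"
          proof -
            have "\<epsilon> powr q \<le> norm (y - x) powr q" using y \<epsilon> q_pos by (intro powr_mono2) auto
            then have "\<Theta> powr q / norm (y - x) powr q \<le> \<Theta> powr q / \<epsilon> powr q"
              using \<epsilon> y by (intro divide_left_mono mult_pos_pos) auto
            then show ?thesis
              using kernel_powr_le[OF N, of q "y - x"] \<theta> q_pos by linarith
          qed
          ultimately have "\<bar>(y - x) \<bullet> v\<bar> * (1 / N (y - x) powr q) \<le> (r * norm v) * (\<Theta> powr q / \<epsilon> powr q)"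
            using r by (intro mult_mono) auto
          then show ?thesis using True r by (simp add: G_def abs_mult)
        qed (simp add: G_def)
        then show "AE y in lborel. norm (G y)
            \<le> norm (r * norm v * (\<Theta> powr q / \<epsilon> powr q) * indicator (ball x r) y)"
          by simp
      qed simp
    qed
    also have "(LINT y|lborel. G y) = 0"
    proof (rule integral_odd_about[of _ x])
      fix y
      have e: "2 *\<^sub>R x - y - x = - (y - x)"
        by (simp add: scaleR_2)
      have "dist x (2 *\<^sub>R x - y) = dist x y"
        by (simp add: dist_norm scaleR_2 norm_minus_commute)
      moreover have "N (- (y - x)) = N (y - x)"
        using N unfolding kernel_norm_def by blast
      ultimately show "G (2 *\<^sub>R x - y) = - G y"
        unfolding G_def e by (simp add: indicator_def inner_diff_left diff_divide_distrib)
    qed simp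
    finally show ?thesis by simp
  qed
  have lim: "(I \<longlongrightarrow> (LINT y|lborel. T y / N (y - x) powr q)) (at_right 0)"
  proof (rule tendsto_at_right_sequentially[of 0 1])
    fix S :: "nat \<Rightarrow> real" assume S: "\<And>n. 0 < S n" "S \<longlonglongrightarrow> 0"
    show "(\<lambda>n. I (S n)) \<longlonglongrightarrow> (LINT y|lborel. T y / N (y - x) powr q)"
      unfolding I_def
    proof (rule integral_dominated_convergence[where w = "\<lambda>y. \<bar>T y / N (y - x) powr q\<bar>"])
      \<comment> \<open>Pointwise convergence includes \<open>y = x\<close>: there the truncated
        integrand is always 0, which agrees with the limit because \<open>T x = 0\<close>.\<close>
      have "(\<lambda>n. indicator (- ball x (S n)) y * (T y / N (y - x) powr q))
          \<longlonglongrightarrow> T y / N (y - x) powr q" for y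
      proof (cases "y = x")
        case False
        then have "eventually (\<lambda>n. S n < dist x y) sequentially"
          using order_tendstoD(2)[OF S(2), of "dist x y"] by simp
        then have "eventually (\<lambda>n. indicator (- ball x (S n)) y * (T y / N (y - x) powr q)
            = T y / N (y - x) powr q) sequentially"
          by eventually_elim auto
        then show ?thesis by (rule tendsto_eventually)
      qed (use r in \<open>simp add: T_def\<close>)
      then show "AE y in lborel. (\<lambda>n. indicator (- ball x (S n)) y * (T y / N (y - x) powr q))
          \<longlonglongrightarrow> T y / N (y - x) powr q"
        by simp
      show "integrable lborel (\<lambda>y. \<bar>T y / N (y - x) powr q\<bar>)"
        using integrable_T by (rule integrable_abs)
    qed (auto simp: indicator_def)
  qed simp
  have "((\<lambda>\<epsilon>. LINT y:- ball x \<epsilon>|lebesgue. (u y - u x) / N (y - x) powr q)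
      \<longlongrightarrow> (LINT y|lborel. T y / N (y - x) powr q)) (at_right 0)"
  proof (rule Lim_transform_eventually[OF lim])
    have "eventually (\<lambda>\<epsilon>. \<epsilon> \<in> {0<..<r}) (at_right 0)"
      using eventually_at_right_real[OF r] .
    then show "eventually (\<lambda>\<epsilon>. I \<epsilon> = (LINT y:- ball x \<epsilon>|lebesgue. (u y - u x) / N (y - x) powr q)) (at_right 0)"
      by eventually_elim (simp add: truncated)
  qed
  then show ?thesis
    unfolding pv_integral_def T_def by (intro tendsto_Lim) auto
qed

end

section \<open>Lower bounds at an antisymmetric minimum\<close>

text \<open>As \<open>q - 2 \<ge> 0\<close>, \<open>b powr q - a powr q\<close> is at least
  \<open>b powr (q - 2)\<close> times the difference of squares. A gap between squared distances
  thus becomes a gap between kernel values.\<close>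

lemma inverse_powr_diff_ge:
  fixes a b q :: real
  assumes "0 < a" "a \<le> b" "2 \<le> q"
  shows "(b\<^sup>2 - a\<^sup>2) / b powr (q + 2) \<le> 1 / a powr q - 1 / b powr q"
proof -
  have sq: "c powr q = c powr (q - 2) * c\<^sup>2" if "0 < c" for c
    using that by (simp add: powr_diff)
  have "a powr (q - 2) * a\<^sup>2 \<le> b powr (q - 2) * a\<^sup>2"
    using assms by (intro mult_right_mono powr_mono2) auto
  then have num: "b powr (q - 2) * (b\<^sup>2 - a\<^sup>2) \<le> b powr q - a powr q"
    using assms by (simp add: sq algebra_simps)
  have den: "a powr q \<le> b powr q" using assms by (intro powr_mono2) auto
  have "(b\<^sup>2 - a\<^sup>2) / b powr (q + 2) = b powr (q - 2) * (b\<^sup>2 - a\<^sup>2) / (b powr q * b powr q)"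
  proof -
    have "b powr (q + 2) = b powr q * b\<^sup>2" "b powr (q - 2) = b powr q / b\<^sup>2"
      using assms by (simp_all add: powr_add powr_diff)
    then show ?thesis using assms by simp
  qed
  also have "\<dots> \<le> (b powr q - a powr q) / (b powr q * b powr q)"
    using num by (intro divide_right_mono) auto
  also have "\<dots> \<le> (b powr q - a powr q) / (a powr q * b powr q)"
    using assms den by (intro divide_left_mono mult_right_mono mult_pos_pos) auto
  also have "\<dots> = 1 / a powr q - 1 / b powr q"
    using assms by (simp add: field_simps)
  finally show ?thesis .
qed

lemma kernel_norm_pos:
  assumes "kernel_norm \<theta> \<Theta> k N" "0 < \<Theta>" "z \<noteq> 0"
  shows "0 < N z"
proof -
  have "0 < norm z / \<Theta>" using assms by simp
  also have "\<dots> \<le> N z" using assms by (simp add: kernel_norm_def)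
  finally show ?thesis .
qed

context
  fixes w N :: "real^'n \<Rightarrow> real" and q \<theta> \<Theta> \<mu> :: real and x :: "real^'n" and k
  assumes w_borel [measurable]: "w \<in> borel_measurable borel"
    and anti: "\<And>y. w (reflect k \<mu> y) = - w y"
    and min: "\<And>y. y $ k < \<mu> \<Longrightarrow> w x \<le> w y"
    and x: "x $ k < \<mu>" and wx: "w x \<le> 0"
    and N: "kernel_norm \<theta> \<Theta> k N" and \<theta>: "0 < \<theta>" "\<theta> \<le> \<Theta>" and q: "2 \<le> q"
    and int: "integrable lborel (\<lambda>y. (w y - w x) / N (y - x) powr q)"
begin

private definition "H y = (w y - w x) / N (y - x) powr q"

private lemma N_borel [measurable]: "N \<in> borel_measurable borel"
  using N by (rule kernel_norm_measurable)

private lemma H_borel [measurable]: "H \<in> borel_measurable borel"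
  unfolding H_def by measurable

private lemma N_pos: "z \<noteq> 0 \<Longrightarrow> 0 < N z"
  using kernel_norm_pos[OF N] \<theta> by auto

text \<open>Antisymmetry pairs \<open>y\<close> with its mirror image. For \<open>y\<close> left of
  the plane both products are nonnegative: the first by minimality and because the mirror image is
  farther from \<open>x\<close>, the second because \<open>w x \<le> 0\<close>. Each of the two
  final bounds keeps one of them.\<close>

private lemma H_sum:
  "H y + H (reflect k \<mu> y) = (w y - w x) * (1 / N (y - x) powr q - 1 / N (reflect k \<mu> y - x) powr q)
     + (- 2 * w x) * (1 / N (reflect k \<mu> y - x) powr q)"
proof -
  have "(a - b) / c + (- a - b) / d = (a - b) * (1 / c - 1 / d) + (- 2 * b) * (1 / d)" for a b c d :: real
    by (simp add: divide_inverse left_diff_distrib right_diff_distrib)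
  then show ?thesis unfolding H_def anti .
qed

private lemma kernel_diff:
  assumes y: "y $ k < \<mu>" "y \<noteq> x"
  shows "4 * (\<mu> - x $ k) * (\<mu> - y $ k) / \<Theta>\<^sup>2 / N (reflect k \<mu> y - x) powr (q + 2)
    \<le> 1 / N (y - x) powr q - 1 / N (reflect k \<mu> y - x) powr q"
proof -
  let ?a = "N (y - x)" and ?b = "N (reflect k \<mu> y - x)"
  have a: "0 < ?a" using y by (intro N_pos) auto
  have "reflect k \<mu> y $ k \<noteq> x $ k" using x y by simp
  then have b: "0 < ?b" by (intro N_pos) auto
  have d: "4 * (\<mu> - x $ k) * (\<mu> - y $ k) / \<Theta>\<^sup>2 \<le> ?b\<^sup>2 - ?a\<^sup>2"
    by (rule kernel_norm_reflect_diff[OF N \<theta>(1) x y(1)])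
  moreover have "0 \<le> 4 * (\<mu> - x $ k) * (\<mu> - y $ k) / \<Theta>\<^sup>2"
    using x y by simp
  ultimately have "?a\<^sup>2 \<le> ?b\<^sup>2" by linarith
  then have le: "?a \<le> ?b" using b by (metis less_imp_le power2_le_imp_le)
  have "4 * (\<mu> - x $ k) * (\<mu> - y $ k) / \<Theta>\<^sup>2 / ?b powr (q + 2) \<le> (?b\<^sup>2 - ?a\<^sup>2) / ?b powr (q + 2)"
    by (rule divide_right_mono[OF d]) simp
  also have "\<dots> \<le> 1 / ?a powr q - 1 / ?b powr q"
    by (rule inverse_powr_diff_ge[OF a le q])
  finally show ?thesis .
qed

private lemma H_sum_ge:
  assumes y: "y $ k < \<mu>"
  shows "(- 2 * w x) * (1 / N (reflect k \<mu> y - x) powr q) \<le> H y + H (reflect k \<mu> y)"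
proof (cases "y = x")
  case False
  have "0 \<le> 4 * (\<mu> - x $ k) * (\<mu> - y $ k) / \<Theta>\<^sup>2 / N (reflect k \<mu> y - x) powr (q + 2)"
    using x y by simp
  with kernel_diff[OF y False] min[OF y] show ?thesis
    unfolding H_sum by (simp add: mult_nonneg_nonneg)
qed (simp add: H_sum)

text \<open>
  Folding the integral over the reflection; the hyperplane itself contributes nothing negative
  because \<open>w\<close> vanishes there.
\<close>

private lemma integral_H_ge:
  assumes c: "0 \<le> c" and \<rho>: "0 \<le> \<rho>" and sub: "\<And>y. y \<in> ball z \<rho> \<Longrightarrow> y $ k < \<mu>"
    and ge: "\<And>y. y \<in> ball z \<rho> \<Longrightarrow> c \<le> H y + H (reflect k \<mu> y)"
  shows "c * measure lborel (ball z \<rho>) \<le> (LINT y|lborel. H y)"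
proof -
  \<comment> \<open>\<open>S\<close> vanishes to the right of the plane, so its symmetrisation stays
    pointwise below that of \<open>H\<close>. Both integrals double, and the factor 2
    cancels.\<close>
  define S where "S y = c * indicator (ball z \<rho>) y" for y
  have [measurable]: "S \<in> borel_measurable borel" unfolding S_def by measurable
  have intS: "integrable lborel S"
    unfolding S_def using \<rho> by (intro integrable_mult_right integrable_real_indicator) (auto simp: emeasure_ball)
  have intH: "integrable lborel H" using int unfolding H_def .
  have half: "S y \<le> H y + H (reflect k \<mu> y)" if "y $ k < \<mu>" for y
  proof (cases "y \<in> ball z \<rho>")
    case True
    then show ?thesis using ge by (simp add: S_def)
  next
    case False
    have "0 \<le> (- 2 * w x) * (1 / N (reflect k \<mu> y - x) powr q)" using wx by (intro mult_nonneg_nonneg[of "- 2 * w x"]) simp_all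
    then show ?thesis using False H_sum_ge[OF that] by (simp add: S_def)
  qed
  have zero: "S y = 0" if "\<mu> \<le> y $ k" for y
    using sub[of y] that by (auto simp: S_def indicator_def)
  have "S y + S (reflect k \<mu> y) \<le> H y + H (reflect k \<mu> y)" for y
  proof -
    consider "y $ k < \<mu>" | "y $ k = \<mu>" | "\<mu> < y $ k" by linarith
    then show ?thesis
    proof cases
      case 1
      then show ?thesis using half[of y] zero[of "reflect k \<mu> y"] by simp
    next
      case 2
      then have r: "reflect k \<mu> y = y" by (simp add: vec_eq_iff)
      then have "w y = 0" using anti[of y] by simp
      then have "0 \<le> H y" using wx by (simp add: H_def divide_nonpos_nonneg)
      then show ?thesis using 2 r zero[of y] by simp
    next
      case 3
      then show ?thesis using half[of "reflect k \<mu> y"] zero[of y] by simp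
    qed
  qed
  then have "(LINT y|lborel. S y + S (reflect k \<mu> y)) \<le> (LINT y|lborel. H y + H (reflect k \<mu> y))"
    using intS intH by (intro integral_mono Bochner_Integration.integrable_add) (auto simp: integrable_reflect[of S] integrable_reflect[of H])
  also have "(LINT y|lborel. S y + S (reflect k \<mu> y)) = 2 * (LINT y|lborel. S y)"
    using intS by (simp add: integrable_reflect[of S] integral_reflect[of S])
  also have "(LINT y|lborel. H y + H (reflect k \<mu> y)) = 2 * (LINT y|lborel. H y)"
    using intH by (simp add: integrable_reflect[of H] integral_reflect[of H])
  finally show ?thesis using \<rho> by (simp add: S_def)
qed

text \<open>Keeps the product with \<open>- 2 * w x\<close>, on the ball about \<open>x\<close> that
  touches the plane. Mirror images of its points are within three times its radius of
  \<open>x\<close>: one radius inside the reflected ball and two between the centres.\<close>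

lemma antisymmetric_minimum_bound:
  "2 * \<bar>w x\<bar> * (3 * (\<mu> - x $ k) / \<theta>) powr (- q) * measure lborel (ball x (\<mu> - x $ k))
     \<le> (LINT y|lborel. (w y - w x) / N (y - x) powr q)"
proof -
  define d where "d = \<mu> - x $ k"
  have d: "0 < d" using x by (simp add: d_def)
  have "2 * \<bar>w x\<bar> * (3 * d / \<theta>) powr (- q) * measure lborel (ball x d) \<le> (LINT y|lborel. H y)"
  proof (rule integral_H_ge)
    fix y assume y: "y \<in> ball x d"
    have "\<bar>y $ k - x $ k\<bar> < d"
      using component_le_norm_cart[of "y - x" k] y by (simp add: dist_norm norm_minus_commute)
    then show yk: "y $ k < \<mu>" by (simp add: d_def)
    have "norm (reflect k \<mu> y - x) \<le> norm (reflect k \<mu> y - reflect k \<mu> x) + norm (reflect k \<mu> x - x)"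
      by norm
    also have "norm (reflect k \<mu> x - x) = 2 * d"
    proof -
      have "norm (axis k (1::real)) = 1" by (simp add: norm_eq_sqrt_inner inner_axis_axis)
      then show ?thesis using d by (simp add: reflect_conv_axis d_def)
    qed
    also have "norm (reflect k \<mu> y - reflect k \<mu> x) < d"
      using y by (simp add: reflect_diff dist_norm norm_minus_commute)
    finally have "norm (reflect k \<mu> y - x) \<le> 3 * d" by simp
    then have "norm (reflect k \<mu> y - x) / \<theta> \<le> 3 * d / \<theta>" using \<theta> by (intro divide_right_mono) auto
    moreover have "N (reflect k \<mu> y - x) \<le> norm (reflect k \<mu> y - x) / \<theta>"
      using N by (simp add: kernel_norm_def)
    ultimately have le: "N (reflect k \<mu> y - x) \<le> 3 * d / \<theta>" by linarith
    have "reflect k \<mu> y $ k \<noteq> x $ k" using x yk by simp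
    then have "0 < N (reflect k \<mu> y - x)" by (intro N_pos) auto
    then have "(3 * d / \<theta>) powr (- q) \<le> N (reflect k \<mu> y - x) powr (- q)"
      using le q by (intro powr_mono2') auto
    then have "(- 2 * w x) * (3 * d / \<theta>) powr (- q) \<le> (- 2 * w x) * N (reflect k \<mu> y - x) powr (- q)"
      using wx by (intro mult_left_mono) auto
    then have "2 * \<bar>w x\<bar> * (3 * d / \<theta>) powr (- q) \<le> (- 2 * w x) * (1 / N (reflect k \<mu> y - x) powr q)"
      using wx by (simp add: powr_minus_divide)
    also have "\<dots> \<le> H y + H (reflect k \<mu> y)" by (rule H_sum_ge[OF yk])
    finally show "2 * \<bar>w x\<bar> * (3 * d / \<theta>) powr (- q) \<le> H y + H (reflect k \<mu> y)" .
  qed (use d in auto)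
  then show ?thesis by (simp add: H_def d_def)
qed

text \<open>Keeps the product with \<open>w y - w x\<close>, which is at least \<open>m\<close> on
  the ball. The distance of the ball from the plane is at least \<open>e\<close>, and
  \<open>P / \<theta>\<close> bounds \<open>N\<close> at the mirror images.\<close>

lemma antisymmetric_positivity_bound:
  assumes m: "0 < m" and e: "0 < e" and \<rho>: "0 \<le> \<rho>"
    and ball: "\<And>y. y \<in> ball z \<rho> \<Longrightarrow> e \<le> \<mu> - y $ k \<and> m \<le> w y \<and> norm (reflect k \<mu> y - x) \<le> P"
  shows "m * (4 * (\<mu> - x $ k) * e / \<Theta>\<^sup>2 / (P / \<theta>) powr (q + 2)) * measure lborel (ball z \<rho>)
     \<le> (LINT y|lborel. (w y - w x) / N (y - x) powr q)"
proof -
  let ?\<kappa> = "4 * (\<mu> - x $ k) * e / \<Theta>\<^sup>2 / (P / \<theta>) powr (q + 2)"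
  have "m * ?\<kappa> * measure lborel (ball z \<rho>) \<le> (LINT y|lborel. H y)"
  proof (rule integral_H_ge)
    show "0 \<le> m * ?\<kappa>" using m x e by simp
    fix y assume "y \<in> ball z \<rho>"
    then have y: "e \<le> \<mu> - y $ k" "m \<le> w y" "norm (reflect k \<mu> y - x) \<le> P" using ball by auto
    then show yk: "y $ k < \<mu>" using e by simp
    have "y \<noteq> x" using y m wx by auto
    have "reflect k \<mu> y $ k \<noteq> x $ k" using x yk by simp
    then have b: "0 < N (reflect k \<mu> y - x)" by (intro N_pos) auto
    have "N (reflect k \<mu> y - x) \<le> norm (reflect k \<mu> y - x) / \<theta>"
      using N by (simp add: kernel_norm_def)
    also have "\<dots> \<le> P / \<theta>" using \<theta> y by (intro divide_right_mono) auto
    finally have le: "N (reflect k \<mu> y - x) \<le> P / \<theta>" .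
    have "?\<kappa> \<le> 4 * (\<mu> - x $ k) * (\<mu> - y $ k) / \<Theta>\<^sup>2 / N (reflect k \<mu> y - x) powr (q + 2)"
    proof (rule frac_le)
      show "4 * (\<mu> - x $ k) * e / \<Theta>\<^sup>2 \<le> 4 * (\<mu> - x $ k) * (\<mu> - y $ k) / \<Theta>\<^sup>2"
        using x y(1) by (intro divide_right_mono mult_left_mono) auto
      show "N (reflect k \<mu> y - x) powr (q + 2) \<le> (P / \<theta>) powr (q + 2)"
        using b le q by (intro powr_mono2) auto
    qed (use b x yk in auto)
    also have "\<dots> \<le> 1 / N (y - x) powr q - 1 / N (reflect k \<mu> y - x) powr q"
      by (rule kernel_diff[OF yk \<open>y \<noteq> x\<close>])
    finally have "m * ?\<kappa> \<le> (w y - w x) * (1 / N (y - x) powr q - 1 / N (reflect k \<mu> y - x) powr q)"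
    proof (rule mult_mono[rotated])
      show "0 \<le> ?\<kappa>" using x e by simp
    qed (use m y wx in auto)
    moreover have "0 \<le> (- 2 * w x) * (1 / N (reflect k \<mu> y - x) powr q)"
      using wx by (intro mult_nonneg_nonneg[of "- 2 * w x"]) simp_all
    ultimately show "m * ?\<kappa> \<le> H y + H (reflect k \<mu> y)" unfolding H_sum by linarith
  qed (use \<rho> in auto)
  then show ?thesis by (simp add: H_def)
qed

end

section \<open>Critical points of the moving plane\<close>

lemma linear_functional_inner:
  fixes F :: "'a::euclidean_space \<Rightarrow> real"
  assumes "linear F"
  shows "F h = h \<bullet> (\<Sum>b\<in>Basis. F b *\<^sub>R b)"
proof -
  have "F h = F (\<Sum>b\<in>Basis. (h \<bullet> b) *\<^sub>R b)" by (simp add: euclidean_representation)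
  also have "\<dots> = (\<Sum>b\<in>Basis. (h \<bullet> b) * F b)"
    using assms by (simp add: linear_sum linear_scale)
  finally show ?thesis by (simp add: inner_sum_right mult.commute)
qed

text \<open>Riesz representation gives a candidate and uniqueness of derivatives makes it the only
  one, so the definite description in \<open>grad\<close> denotes it.\<close>

lemma has_derivative_grad:
  fixes u :: "real^'n \<Rightarrow> real"
  assumes "u differentiable (at x)"
  shows "(u has_derivative (\<lambda>h. h \<bullet> grad u x)) (at x)"
proof -
  obtain F where F: "(u has_derivative F) (at x)"
    using assms by (auto simp: differentiable_def)
  define D where "D = (\<Sum>b\<in>Basis. F b *\<^sub>R b)"
  have "F = (\<lambda>h. h \<bullet> D)"
    unfolding D_def using linear_functional_inner[OF has_derivative_linear[OF F]] by blast
  then have D: "GDERIV u x :> D" using F by (simp add: gderiv_def)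
  moreover have "E = D" if "GDERIV u x :> E" for E
  proof -
    have "(\<lambda>h. h \<bullet> E) = (\<lambda>h. h \<bullet> D)"
      using that D by (intro has_derivative_unique[of u _ x]) (simp_all add: gderiv_def)
    then have "\<forall>h. h \<bullet> E = h \<bullet> D" by (simp add: fun_eq_iff)
    then show ?thesis using vector_eq_ldot by blast
  qed
  ultimately have "GDERIV u x :> grad u x"
    unfolding grad_def by (rule theI)
  then show ?thesis by (simp add: gderiv_def)
qed

text \<open>Mean value theorem on the segment from \<open>x\<close> to \<open>y\<close>, then the
  Lipschitz bound for the gradient at the intermediate point.\<close>

lemma taylor_lipschitz_grad:
  fixes u :: "real^'n \<Rightarrow> real"
  assumes diff: "\<And>y. y \<in> ball x r \<Longrightarrow> u differentiable (at y)"
    and lip: "L-lipschitz_on (ball x r) (grad u)" and y: "y \<in> ball x r"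
  shows "\<bar>u y - u x - (y - x) \<bullet> grad u x\<bar> \<le> L * (norm (y - x))\<^sup>2"
proof -
  let ?p = "\<lambda>t. x + t *\<^sub>R (y - x)"
  have p: "?p t \<in> ball x r" if "0 \<le> t" "t \<le> 1" for t
  proof -
    have "t * norm (y - x) \<le> 1 * norm (y - x)" using that by (intro mult_right_mono) auto
    then show ?thesis using y that by (simp add: dist_norm norm_minus_commute)
  qed
  have "((\<lambda>t. u (?p t)) has_real_derivative ((y - x) \<bullet> grad u (?p t))) (at t)"
    if "0 \<le> t" "t \<le> 1" for t
  proof -
    have "(?p has_derivative (\<lambda>h. h *\<^sub>R (y - x))) (at t)"
      by (auto intro!: derivative_eq_intros)
    from has_derivative_compose[OF this has_derivative_grad[OF diff[OF p[OF that]]]]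
    show ?thesis by (simp add: has_field_derivative_def mult_commute_abs)
  qed
  from MVT2[of 0 1, OF _ this] obtain t where t: "0 < t" "t < 1"
    and eq: "u (?p 1) - u (?p 0) = (1 - 0) * ((y - x) \<bullet> grad u (?p t))"
    by auto
  have "norm (grad u (?p t) - grad u x) \<le> L * norm (y - x)"
  proof -
    have "x \<in> ball x r" using y by (metis centre_in_ball mem_ball dist_not_less_zero le_less_trans not_le)
    then have "dist (grad u (?p t)) (grad u x) \<le> L * dist (?p t) x"
      using t p[of t] by (intro lipschitz_onD[OF lip]) auto
    also have "\<dots> \<le> L * norm (y - x)"
      using t lipschitz_on_nonneg[OF lip]
      by (intro mult_left_mono) (auto simp: dist_norm mult_left_le_one_le)
    finally show ?thesis by (simp add: dist_norm)
  qed
  then have "norm (y - x) * norm (grad u (?p t) - grad u x) \<le> norm (y - x) * (L * norm (y - x))"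
    by (rule mult_left_mono) simp
  moreover have "u y - u x - (y - x) \<bullet> grad u x = (y - x) \<bullet> (grad u (?p t) - grad u x)"
    using eq by (simp add: inner_diff_right)
  moreover have "\<bar>(y - x) \<bullet> (grad u (?p t) - grad u x)\<bar> \<le> norm (y - x) * norm (grad u (?p t) - grad u x)"
    by (rule Cauchy_Schwarz_ineq2)
  ultimately have "\<bar>u y - u x - (y - x) \<bullet> grad u x\<bar> \<le> norm (y - x) * (L * norm (y - x))"
    by linarith
  then show ?thesis by (simp add: power2_eq_square mult_ac)
qed

text \<open>\<open>c0\<close> is the factor that remains when
  \<open>(3 * d / \<theta>) powr (- q)\<close> times the volume of a ball of radius \<open>d\<close>
  is written as a multiple of \<open>d powr (- 2 * s)\<close>.\<close>

locale moving_planes =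
  fixes s \<theta> \<Theta> :: real and k :: "'n::finite" and \<Omega> :: "(real^'n) set"
    and f :: "real^'n \<Rightarrow> real \<Rightarrow> real^'n \<Rightarrow> real" and u :: "real^'n \<Rightarrow> real"
    and q c0 :: real
  assumes n: "CARD('n) \<ge> 2" and s: "0 < s" "s < 1" and \<theta>: "0 < \<theta>" "\<theta> \<le> \<Theta>"
    and open_\<Omega>: "open \<Omega>" and convex: "convex_in_dir k \<Omega>" and symmetric: "reflect k 0 ` \<Omega> = \<Omega>"
    and f_class: "f \<in> nonlin_class \<Omega>" and C11: "u \<in> C11_loc \<Omega>"
    and cont: "continuous_on (closure \<Omega>) u" and L_space: "u \<in> L_space s"
    and equation: "\<And>x. x \<in> \<Omega> \<Longrightarrow> - Fs s \<theta> \<Theta> (axis k 1) u x = f x (u x) (grad u x)"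
    and positive: "\<And>x. x \<in> \<Omega> \<Longrightarrow> 0 < u x" and zero_outside: "\<And>x. x \<notin> \<Omega> \<Longrightarrow> u x = 0"
    and f_mono: "\<And>x v p t. x \<in> \<Omega> \<Longrightarrow> x $ k \<le> 0 \<Longrightarrow> 0 \<le> p $ k \<Longrightarrow> x $ k \<le> t \<Longrightarrow> t \<le> - (x $ k) \<Longrightarrow>
       f x v p \<le> f (set_coord k t x) v (set_coord k (- (p $ k)) p)"
    and q_def: "q = real CARD('n) + 2 * s"
    and c0_def: "c0 = (3 / \<theta>) powr (- q) * unit_ball_vol (real CARD('n))"
begin

section \<open>Basic properties of the reflected difference\<close>

definition w :: "real \<Rightarrow> real^'n \<Rightarrow> real" where "w \<mu> x = u (reflect k \<mu> x) - u x"

lemma q_ge: "2 \<le> q"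
  using n s by (simp add: q_def)

lemma u_nonneg: "0 \<le> u x"
  using positive[of x] zero_outside[of x] by (cases "x \<in> \<Omega>") auto

text \<open>\<open>u\<close> is 0 on the closed complement of \<open>\<Omega>\<close>, so two
  continuous pieces on closed sets are glued.\<close>

lemma cont_u: "continuous_on UNIV u"
proof -
  have "continuous_on (- \<Omega>) u"
    using zero_outside by (intro continuous_on_eq[OF continuous_on_const[of _ 0]]) auto
  then have "continuous_on (closure \<Omega> \<union> - \<Omega>) u"
    using cont open_\<Omega> by (intro continuous_on_closed_Un) auto
  moreover have "closure \<Omega> \<union> - \<Omega> = UNIV" using closure_subset by blast
  ultimately show ?thesis by simp
qed

lemma u_borel [measurable]: "u \<in> borel_measurable borel"
  by (intro borel_measurable_continuous_onI cont_u)

lemma cont_w: "continuous_on S (\<lambda>p. w (fst p) (snd p))"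
  unfolding w_def by (intro continuous_intros continuous_on_compose2[OF cont_u]) auto

lemma w_reflect: "w \<mu> (reflect k \<mu> x) = - w \<mu> x"
  by (simp add: w_def)

lemma w_borel [measurable]: "w \<mu> \<in> borel_measurable borel"
proof (rule borel_measurable_continuous_onI)
  show "continuous_on UNIV (w \<mu>)"
    unfolding w_def by (intro continuous_intros continuous_on_compose2[OF cont_u]) auto
qed

text \<open>\<open>\<Omega>\<close> contains \<open>x\<close> and its mirror image about 0, hence
  the segment between them.\<close>

lemma set_coord_mem:
  assumes x: "x \<in> \<Omega>" and t: "\<bar>t\<bar> \<le> \<bar>x $ k\<bar>"
  shows "set_coord k t x \<in> \<Omega>"
proof -
  have r: "reflect k 0 x \<in> \<Omega>" using x symmetric by blast
  consider "t = x $ k" | "t = - (x $ k)" | "\<bar>t\<bar> < \<bar>x $ k\<bar>" using t by linarith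
  then show ?thesis
  proof cases
    case 1
    then have "set_coord k t x = x" by (simp add: vec_eq_iff)
    then show ?thesis using x by simp
  next
    case 2
    then show ?thesis using r by (simp add: reflect_def)
  next
    case 3
    \<comment> \<open>The solution of \<open>(2 * a - 1) * x $ k = t\<close>.\<close>
    define a where "a = (1 + t / x $ k) / 2"
    have nz: "x $ k \<noteq> 0" using 3 by auto
    have "\<bar>t / x $ k\<bar> < 1" using 3 nz by (simp add: abs_divide)
    then have "- 1 < t / x $ k" "t / x $ k < 1" unfolding abs_less_iff by linarith+
    then have a: "0 < a" "a < 1" by (simp_all add: a_def)
    have "a *\<^sub>R x + (1 - a) *\<^sub>R reflect k 0 x \<in> \<Omega>"
      using convex x r a unfolding convex_in_dir_def
      by (elim ballE[where x = "reflect k 0 x"] ballE[where x = x]) auto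
    moreover have "a *\<^sub>R x + (1 - a) *\<^sub>R reflect k 0 x = set_coord k t x"
      using nz by (auto simp: vec_eq_iff a_def field_simps)
    ultimately show ?thesis by simp
  qed
qed

lemma reflect_mem:
  assumes "x \<in> \<Omega>" "x $ k < \<mu>" "\<mu> \<le> 0"
  shows "reflect k \<mu> x \<in> \<Omega>"
  unfolding reflect_def using assms by (intro set_coord_mem) auto

lemma w_neg_imp_mem: "w \<mu> x < 0 \<Longrightarrow> x \<in> \<Omega>"
  using zero_outside[of x] u_nonneg[of "reflect k \<mu> x"] by (fastforce simp: w_def)

lemma diff_u: "x \<in> \<Omega> \<Longrightarrow> u differentiable (at x)"
  using C11 by (simp add: C11_loc_def)

lemma taylor:
  assumes "x \<in> \<Omega>"
  obtains r L where "0 < r" "\<And>y. y \<in> ball x r \<Longrightarrow> \<bar>u y - u x - (y - x) \<bullet> grad u x\<bar> \<le> L * (norm (y - x))\<^sup>2"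
proof -
  obtain r1 L where 1: "0 < r1" "L-lipschitz_on (ball x r1 \<inter> \<Omega>) (grad u)"
    using C11 assms unfolding C11_loc_def by blast
  obtain r2 where 2: "0 < r2" "ball x r2 \<subseteq> \<Omega>"
    using open_\<Omega> assms openE by blast
  define r where "r = min r1 r2"
  have sub: "ball x r \<subseteq> ball x r1 \<inter> \<Omega>" using 2 by (auto simp: r_def)
  show ?thesis
  proof (rule that[of r L])
    show "0 < r" using 1 2 by (simp add: r_def)
    show "\<bar>u y - u x - (y - x) \<bullet> grad u x\<bar> \<le> L * (norm (y - x))\<^sup>2" if "y \<in> ball x r" for y
      using that sub by (intro taylor_lipschitz_grad lipschitz_on_subset[OF 1(2)] diff_u) auto
  qed
qed

text \<open>After reflecting the integral at the mirror image, the gradient condition cancels the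
  first-order terms and leaves an absolutely convergent integral of the increments of
  \<open>w \<mu>\<close>. Since \<open>B\<close> is the same for all kernels, it survives the
  infimum.\<close>

lemma Fs_diff_ge:
  assumes x: "x \<in> \<Omega>" and rx: "reflect k \<mu> x \<in> \<Omega>"
    and grad: "grad u x = reflect k 0 (grad u (reflect k \<mu> x))"
    and B: "\<And>N. kernel_norm \<theta> \<Theta> k N \<Longrightarrow> integrable lborel (\<lambda>y. (w \<mu> y - w \<mu> x) / N (y - x) powr q) \<Longrightarrow>
       B \<le> (LINT y|lborel. (w \<mu> y - w \<mu> x) / N (y - x) powr q)"
  shows "B \<le> Fs s \<theta> \<Theta> (axis k 1) u (reflect k \<mu> x) - Fs s \<theta> \<Theta> (axis k 1) u x"
proof -
  let ?x' = "reflect k \<mu> x"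
  obtain r1 L1 where 1: "0 < r1"
    "\<And>y. y \<in> ball x r1 \<Longrightarrow> \<bar>u y - u x - (y - x) \<bullet> grad u x\<bar> \<le> L1 * (norm (y - x))\<^sup>2"
    using taylor[OF x] by metis
  obtain r2 L2 where 2: "0 < r2"
    "\<And>y. y \<in> ball ?x' r2 \<Longrightarrow> \<bar>u y - u ?x' - (y - ?x') \<bullet> grad u ?x'\<bar> \<le> L2 * (norm (y - ?x'))\<^sup>2"
    using taylor[OF rx] by metis
  \<comment> \<open>One radius for both points makes the two cutoff balls mirror images.\<close>
  define r where "r = min r1 r2"
  have r: "0 < r" using 1 2 by (simp add: r_def)
  have T1: "\<bar>u y - u x - (y - x) \<bullet> grad u x\<bar> \<le> L1 * (norm (y - x))\<^sup>2" if "y \<in> ball x r" for y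
    using that 1 by (simp add: r_def)
  have T2: "\<bar>u y - u ?x' - (y - ?x') \<bullet> grad u ?x'\<bar> \<le> L2 * (norm (y - ?x'))\<^sup>2" if "y \<in> ball ?x' r" for y
    using that 2 by (simp add: r_def)
  define K where "K A y = norm (matrix_inv A *v y)" for A :: "real^'n^'n" and y
  define a where "a z A = pv_integral z (\<lambda>y. (u y - u z) / K A (y - z) powr q)" for z A
  have Fs: "Fs s \<theta> \<Theta> (axis k 1) u z = (INF A\<in>admissible \<theta> \<Theta> (axis k 1). a z A)" for z
    by (simp add: Fs_def a_def K_def q_def)
  have kernel: "kernel_norm \<theta> \<Theta> k (K A)" if "A \<in> admissible \<theta> \<Theta> (axis k 1)" for A
    unfolding K_def using admissible_kernel_norm[OF that \<theta>(1)] .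
  have diff: "a x A + B \<le> a ?x' A" if A: "A \<in> admissible \<theta> \<Theta> (axis k 1)" for A
  proof -
    note N = kernel[OF A]
    note args1 = L_space u_borel s n r T1 N \<theta> q_def
    note args2 = L_space u_borel s n r T2 N \<theta> q_def
    define H1 where "H1 y = (u y - u x - indicator (ball x r) y * ((y - x) \<bullet> grad u x)) / K A (y - x) powr q" for y
    define H2 where "H2 y = (u y - u ?x' - indicator (ball ?x' r) y * ((y - ?x') \<bullet> grad u ?x')) / K A (y - ?x') powr q" for y
    have i1: "integrable lborel H1" and a1: "a x A = (LINT y|lborel. H1 y)"
      unfolding H1_def a_def by (rule integrable_kernel[OF args1] pv_integral_kernel[OF args1]; assumption)+
    have i2: "integrable lborel H2" and a2: "a ?x' A = (LINT y|lborel. H2 y)"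
      unfolding H2_def a_def by (rule integrable_kernel[OF args2] pv_integral_kernel[OF args2]; assumption)+
    have H2_borel [measurable]: "H2 \<in> borel_measurable borel" using i2 by auto
    have H: "H2 (reflect k \<mu> y) - H1 y = (w \<mu> y - w \<mu> x) / K A (y - x) powr q" for y
    proof -
      have "(reflect k \<mu> y - ?x') \<bullet> grad u ?x' = (y - x) \<bullet> grad u x"
        unfolding reflect_diff grad by (metis inner_reflect reflect_reflect)
      moreover have "K A (reflect k \<mu> y - ?x') = K A (y - x)"
        unfolding reflect_diff by (rule kernel_norm_reflect[OF N \<theta>])
      moreover have "indicator (ball ?x' r) (reflect k \<mu> y) = (indicator (ball x r) y :: real)"
        by (simp add: indicator_def)
      ultimately show ?thesis
        unfolding H1_def H2_def w_def by (simp add: diff_divide_distrib[symmetric])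
    qed
    have i2': "integrable lborel (\<lambda>y. H2 (reflect k \<mu> y))" using i2 by (simp add: integrable_reflect[of H2])
    have r: "(LINT y|lborel. H2 (reflect k \<mu> y)) = (LINT y|lborel. H2 y)"
      by (rule integral_reflect[OF H2_borel])
    have "integrable lborel (\<lambda>y. H2 (reflect k \<mu> y) - H1 y)"
      by (rule Bochner_Integration.integrable_diff[OF i2' i1])
    then have "integrable lborel (\<lambda>y. (w \<mu> y - w \<mu> x) / K A (y - x) powr q)"
      unfolding H .
    note B[OF N this]
    also have "(LINT y|lborel. (w \<mu> y - w \<mu> x) / K A (y - x) powr q) = a ?x' A - a x A"
      unfolding H[symmetric] Bochner_Integration.integral_diff[OF i2' i1] r a1 a2 ..
    finally show ?thesis by simp
  qed
  \<comment> \<open>Boundedness below is what places \<open>Fs\<close> at \<open>x\<close> below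
    each principal value at \<open>x\<close>, the infimum over reals being only conditionally
    complete.\<close>
  have bdd: "bdd_below (a x ` admissible \<theta> \<Theta> (axis k 1))"
  proof (rule bdd_belowI2)
    fix A assume A: "A \<in> admissible \<theta> \<Theta> (axis k 1)"
    note args1 = L_space u_borel s n r T1 kernel[OF A] \<theta> q_def
    have a: "a x A = (LINT y|lborel. (u y - u x - indicator (ball x r) y * ((y - x) \<bullet> grad u x))
         / K A (y - x) powr q)"
      unfolding a_def by (rule pv_integral_kernel[OF args1])
    have "\<bar>a x A\<bar> \<le> \<Theta> powr q * (LINT y|lborel. \<bar>(u y - u x - indicator (ball x r) y * ((y - x) \<bullet> grad u x))
         / norm (y - x) powr q\<bar>)"
      unfolding a by (rule integral_kernel_bound[OF args1])
    then show "- (\<Theta> powr q * (LINT y|lborel. \<bar>(u y - u x - indicator (ball x r) y * ((y - x) \<bullet> grad u x))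
         / norm (y - x) powr q\<bar>)) \<le> a x A"
      by linarith
  qed
  have "Fs s \<theta> \<Theta> (axis k 1) u x + B \<le> Fs s \<theta> \<Theta> (axis k 1) u ?x'"
    unfolding Fs[of ?x']
  proof (rule cINF_greatest)
    show "admissible \<theta> \<Theta> (axis k 1) \<noteq> {}" using admissible_nonempty[OF \<theta>(2)] by blast
    fix A assume A: "A \<in> admissible \<theta> \<Theta> (axis k 1)"
    have "Fs s \<theta> \<Theta> (axis k 1) u x \<le> a x A" unfolding Fs by (rule cINF_lower[OF bdd A])
    then show "Fs s \<theta> \<Theta> (axis k 1) u x + B \<le> a ?x' A" using diff[OF A] by simp
  qed
  then show ?thesis by simp
qed

text \<open>
  Minimality over all planes to the left, and not just over points, is what determines the sign of
  the derivative in the direction of motion, as needed for the monotonicity of \<open>f\<close>.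
\<close>

definition critical :: "real \<Rightarrow> real^'n \<Rightarrow> bool" where
  "critical \<mu> x \<longleftrightarrow> \<mu> \<le> 0 \<and> x \<in> \<Omega> \<and> x $ k < \<mu> \<and> w \<mu> x \<le> 0 \<and>
     (\<forall>\<nu>\<le>\<mu>. \<forall>y. y $ k < \<nu> \<longrightarrow> w \<mu> x \<le> w \<nu> y)"

text \<open>Minimality in the point gives the first claim. Moving the plane left cannot lower
  \<open>w\<close>, so the derivative of \<open>w\<close> in \<open>\<mu>\<close>, twice the
  \<open>k\<close>-th partial derivative of \<open>u\<close> at the mirror image, is at most 0;
  reflection flips the sign.\<close>

lemma critical_grad:
  assumes "critical \<mu> x"
  shows "grad u x = reflect k 0 (grad u (reflect k \<mu> x))" "0 \<le> grad u x $ k"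
proof -
  let ?x' = "reflect k \<mu> x"
  from assms have \<mu>: "\<mu> \<le> 0" and x: "x \<in> \<Omega>" "x $ k < \<mu>"
    and min: "\<And>\<nu> y. \<nu> \<le> \<mu> \<Longrightarrow> y $ k < \<nu> \<Longrightarrow> w \<mu> x \<le> w \<nu> y"
    by (auto simp: critical_def)
  have x': "?x' \<in> \<Omega>" using reflect_mem x \<mu> by blast
  have "((\<lambda>y. u (reflect k \<mu> y)) has_derivative (\<lambda>h. reflect k 0 h \<bullet> grad u ?x')) (at x)"
    by (rule has_derivative_compose[OF has_derivative_reflect has_derivative_grad[OF diff_u[OF x']]])
  then have "(w \<mu> has_derivative (\<lambda>h. reflect k 0 h \<bullet> grad u ?x' - h \<bullet> grad u x)) (at x)"
    unfolding w_def by (intro has_derivative_diff has_derivative_grad diff_u x)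
  moreover have "open {y :: real^'n. y $ k < \<mu>}"
    by (rule open_halfspace_component_lt_cart)
  ultimately have "(\<lambda>h. reflect k 0 h \<bullet> grad u ?x' - h \<bullet> grad u x) = (\<lambda>h. 0)"
    using x min by (intro differential_zero_maxmin[of x "{y. y $ k < \<mu>}" "w \<mu>"]) auto
  then have "h \<bullet> reflect k 0 (grad u ?x') = h \<bullet> grad u x" for h
    by (metis inner_reflect reflect_reflect eq_iff_diff_eq_0)
  then show grad: "grad u x = reflect k 0 (grad u ?x')"
    using vector_eq_ldot by metis
  have "grad u ?x' $ k \<le> 0"
  proof (rule ccontr)
    assume neg: "\<not> grad u ?x' $ k \<le> 0"
    have "((\<lambda>\<nu>. reflect k \<nu> x) has_derivative (\<lambda>h. (2 * h) *\<^sub>R axis k 1)) (at \<mu>)"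
      unfolding reflect_conv_axis by (auto intro!: derivative_eq_intros)
    from has_derivative_compose[OF this has_derivative_grad[OF diff_u[OF x']]]
    have "((\<lambda>\<nu>. u (reflect k \<nu> x)) has_real_derivative 2 * grad u ?x' $ k) (at \<mu>)"
      by (simp add: has_field_derivative_def inner_axis' mult_ac mult_commute_abs)
    from DERIV_pos_inc_left[OF this] neg
    obtain d where d: "0 < d" "\<And>h. 0 < h \<Longrightarrow> h < d \<Longrightarrow> u (reflect k (\<mu> - h) x) < u ?x'" by auto
    \<comment> \<open>Small enough that the shifted plane stays to the right of \<open>x\<close>,
      where minimality applies.\<close>
    define h where "h = min (d / 2) ((\<mu> - x $ k) / 2)"
    have h: "0 < h" "h < d" "x $ k < \<mu> - h" using d x by (auto simp: h_def min_def field_simps)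
    then show False using d(2)[of h] min[of "\<mu> - h" x] by (simp add: w_def)
  qed
  then show "0 \<le> grad u x $ k" by (simp add: grad)
qed

text \<open>The structure condition, with the gradient at \<open>x\<close> and with \<open>t\<close>
  the \<open>k\<close>-th coordinate of the mirror image, compares \<open>f\<close> at the two
  points; then the two equations are subtracted.\<close>

lemma critical_Fs_diff_le:
  assumes crit: "critical \<mu> x"
    and D: "\<bar>f x (u (reflect k \<mu> x)) (grad u x) - f x (u x) (grad u x)\<bar> \<le> D * \<bar>w \<mu> x\<bar>"
  shows "Fs s \<theta> \<Theta> (axis k 1) u (reflect k \<mu> x) - Fs s \<theta> \<Theta> (axis k 1) u x \<le> D * \<bar>w \<mu> x\<bar>"
proof -
  let ?x' = "reflect k \<mu> x"
  from crit have \<mu>: "\<mu> \<le> 0" and x: "x \<in> \<Omega>" "x $ k < \<mu>" by (auto simp: critical_def)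
  have x': "?x' \<in> \<Omega>" using reflect_mem x \<mu> by blast
  have p': "grad u ?x' = set_coord k (- (grad u x $ k)) (grad u x)"
    using critical_grad(1)[OF crit] by (simp add: vec_eq_iff)
  have "f x (u ?x') (grad u x) \<le> f ?x' (u ?x') (grad u ?x')"
    unfolding p' unfolding reflect_def using x \<mu> critical_grad(2)[OF crit] by (intro f_mono) auto
  then show ?thesis using equation[OF x(1)] equation[OF x'] D by linarith
qed

lemma critical_bound:
  assumes crit: "critical \<mu> x"
    and D: "\<bar>f x (u (reflect k \<mu> x)) (grad u x) - f x (u x) (grad u x)\<bar> \<le> D * \<bar>w \<mu> x\<bar>"
    and B: "\<And>N. kernel_norm \<theta> \<Theta> k N \<Longrightarrow> integrable lborel (\<lambda>y. (w \<mu> y - w \<mu> x) / N (y - x) powr q) \<Longrightarrow>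
       B \<le> (LINT y|lborel. (w \<mu> y - w \<mu> x) / N (y - x) powr q)"
  shows "B \<le> D * \<bar>w \<mu> x\<bar>"
proof -
  from crit have "x \<in> \<Omega>" "reflect k \<mu> x \<in> \<Omega>" by (auto simp: critical_def intro: reflect_mem)
  from Fs_diff_ge[OF this critical_grad(1)[OF crit] B] critical_Fs_diff_le[OF crit D]
  show ?thesis by linarith
qed

section \<open>Quantitative bounds at critical points\<close>

lemma c0_pos: "0 < c0"
  using \<theta> by (simp add: c0_def)

text \<open>The minimum bound divided by \<open>\<bar>w \<mu> x\<bar>\<close>. A small
  \<open>D\<close> excludes negative critical points far out, and a fixed \<open>D\<close> keeps
  them away from the plane.\<close>

lemma critical_distance_bound:
  assumes crit: "critical \<mu> x"
    and D: "\<bar>f x (u (reflect k \<mu> x)) (grad u x) - f x (u x) (grad u x)\<bar> \<le> D * \<bar>w \<mu> x\<bar>"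
    and neg: "w \<mu> x < 0"
  shows "2 * c0 * (\<mu> - x $ k) powr (- 2 * s) \<le> D"
proof -
  define d where "d = \<mu> - x $ k"
  from crit have d: "0 < d" by (auto simp: critical_def d_def)
  have "2 * \<bar>w \<mu> x\<bar> * (3 * d / \<theta>) powr (- q) * measure lborel (ball x d) \<le> D * \<bar>w \<mu> x\<bar>"
    unfolding d_def
  proof (rule critical_bound[OF crit D])
    fix N assume N: "kernel_norm \<theta> \<Theta> k N"
      and int: "integrable lborel (\<lambda>y. (w \<mu> y - w \<mu> x) / N (y - x) powr q)"
    show "2 * \<bar>w \<mu> x\<bar> * (3 * (\<mu> - x $ k) / \<theta>) powr (- q) * measure lborel (ball x (\<mu> - x $ k))
        \<le> (LINT y|lborel. (w \<mu> y - w \<mu> x) / N (y - x) powr q)"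
      using crit
      by (intro antisymmetric_minimum_bound[OF w_borel w_reflect _ _ _ N \<theta> q_ge int])
        (auto simp: critical_def)
  qed
  \<comment> \<open>The volume, of order \<open>CARD('n)\<close> in \<open>d\<close>, cancels all of
    \<open>d powr (- q)\<close> but \<open>d powr (- 2 * s)\<close>.\<close>
  moreover have "(3 * d / \<theta>) powr (- q) * measure lborel (ball x d) = c0 * d powr (- 2 * s)"
  proof -
    have "(3 * d / \<theta>) powr (- q) = (3 / \<theta>) powr (- q) * d powr (- q)"
      using d \<theta> by (simp add: powr_mult[symmetric])
    moreover have "measure lborel (ball x d) = unit_ball_vol (real CARD('n)) * d powr CARD('n)"
      using d by (simp add: content_ball powr_realpow)
    moreover have "d powr (- q) * d powr CARD('n) = d powr (- 2 * s)"
      by (simp add: powr_add[symmetric] q_def)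
    ultimately show ?thesis by (simp add: c0_def mult_ac)
  qed
  ultimately have "2 * \<bar>w \<mu> x\<bar> * (c0 * d powr (- 2 * s)) \<le> D * \<bar>w \<mu> x\<bar>"
    by (metis mult.assoc)
  then have "\<bar>w \<mu> x\<bar> * (2 * c0 * d powr (- 2 * s)) \<le> \<bar>w \<mu> x\<bar> * D"
    by (simp only: mult_ac)
  then show ?thesis using neg unfolding d_def by (simp only: mult_le_cancel_left)
qed

text \<open>The left-hand side does not involve \<open>w \<mu> x\<close>, so positivity on one ball
  prevents a critical value from being close to 0.\<close>

lemma critical_positivity_bound:
  assumes crit: "critical \<mu> x"
    and D: "\<bar>f x (u (reflect k \<mu> x)) (grad u x) - f x (u x) (grad u x)\<bar> \<le> D * \<bar>w \<mu> x\<bar>"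
    and "0 < m" "0 < e" "0 \<le> \<rho>"
    and "\<And>y. y \<in> ball z \<rho> \<Longrightarrow> e \<le> \<mu> - y $ k \<and> m \<le> w \<mu> y \<and> norm (reflect k \<mu> y - x) \<le> P"
  shows "m * (4 * (\<mu> - x $ k) * e / \<Theta>\<^sup>2 / (P / \<theta>) powr (q + 2)) * measure lborel (ball z \<rho>)
     \<le> D * \<bar>w \<mu> x\<bar>"
proof (rule critical_bound[OF crit D])
  fix N assume N: "kernel_norm \<theta> \<Theta> k N"
    and int: "integrable lborel (\<lambda>y. (w \<mu> y - w \<mu> x) / N (y - x) powr q)"
  show "m * (4 * (\<mu> - x $ k) * e / \<Theta>\<^sup>2 / (P / \<theta>) powr (q + 2)) * measure lborel (ball z \<rho>)
      \<le> (LINT y|lborel. (w \<mu> y - w \<mu> x) / N (y - x) powr q)"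
    using crit
    by (intro antisymmetric_positivity_bound[OF w_borel w_reflect _ _ _ N \<theta> q_ge int assms(3-6)])
      (auto simp: critical_def)
qed

end

section \<open>Moving the plane\<close>

text \<open>The strict bound on \<open>D\<close> is the one that contradicts
  \<open>critical_distance_bound\<close>, since for \<open>\<mu> \<le> 0\<close> the distance
  \<open>\<mu> - x $ k\<close> is at most \<open>norm x\<close>.\<close>

locale moving_planes_decay = moving_planes +
  assumes decay: "\<And>\<epsilon>. 0 < \<epsilon> \<Longrightarrow> \<exists>R. \<forall>x\<in>\<Omega>. x $ k < 0 \<and> R \<le> norm x \<longrightarrow> u x < \<epsilon>"
    and small_lipschitz: "\<exists>R. \<forall>x\<in>\<Omega>. x $ k < 0 \<and> R \<le> norm x \<longrightarrow>
       (\<exists>D < 2 * c0 * norm x powr (- 2 * s). \<forall>v p. 0 < v \<and> v < u x \<longrightarrow> \<bar>f x v p - f x (u x) p\<bar> \<le> D * \<bar>v - u x\<bar>)"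
begin

definition nonneg_upto :: "real \<Rightarrow> bool" where
  "nonneg_upto \<mu> \<longleftrightarrow> (\<forall>\<nu>\<le>\<mu>. \<forall>x. x $ k < \<nu> \<longrightarrow> 0 \<le> w \<nu> x)"

text \<open>On a compact set of planes and points the minimum is attained. Beyond the radius
  \<open>R'\<close> decay keeps \<open>w\<close> above the negative starting value, so this minimum
  is global.\<close>

lemma ex_critical:
  assumes \<mu>: "\<mu> \<le> 0" and neg: "\<not> nonneg_upto \<mu>"
  obtains \<nu> x where "\<nu> \<le> \<mu>" "critical \<nu> x" "w \<nu> x < 0"
proof -
  from neg obtain \<nu>1 x1 where 1: "\<nu>1 \<le> \<mu>" "x1 $ k < \<nu>1" "w \<nu>1 x1 < 0"
    by (auto simp: nonneg_upto_def not_le)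
  then obtain R where R: "\<And>x. x \<in> \<Omega> \<Longrightarrow> x $ k < 0 \<Longrightarrow> R \<le> norm x \<Longrightarrow> u x < - w \<nu>1 x1"
    using decay[of "- w \<nu>1 x1"] by auto
  define R' where "R' = max R (norm x1)"
  \<comment> \<open>Points on the plane itself are included to make \<open>S\<close> closed; the
    minimum is not there, because \<open>w\<close> vanishes on the plane.\<close>
  define S where "S = {p. norm (snd p) \<le> R' \<and> snd p $ k \<le> fst p \<and> fst p \<le> \<mu>}"
  have "S \<subseteq> {- R'..\<mu>} \<times> cball 0 R'"
  proof
    fix p assume p: "p \<in> S"
    have "\<bar>snd p $ k\<bar> \<le> norm (snd p)" by (rule component_le_norm_cart)
    with p show "p \<in> {- R'..\<mu>} \<times> cball 0 R'" by (cases p) (auto simp: S_def)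
  qed
  moreover have "bounded ({- R'..\<mu>} \<times> cball (0::real^'n) R')"
    by (intro bounded_Times) auto
  ultimately have "bounded S" by (rule bounded_subset[rotated])
  moreover have "closed S"
    unfolding S_def by (intro closed_Collect_conj closed_Collect_le continuous_intros)
  ultimately have "compact S" by (simp add: compact_eq_bounded_closed)
  moreover have S1: "(\<nu>1, x1) \<in> S" using 1 by (simp add: S_def R'_def)
  ultimately obtain p where p: "p \<in> S" "\<And>p'. p' \<in> S \<Longrightarrow> w (fst p) (snd p) \<le> w (fst p') (snd p')"
    using continuous_attains_inf[of S "\<lambda>p. w (fst p) (snd p)", OF _ _ cont_w] by blast
  define \<nu> x where "\<nu> = fst p" and "x = snd p"
  have \<nu>: "\<nu> \<le> \<mu>" and xk: "x $ k \<le> \<nu>" using p by (auto simp: S_def \<nu>_def x_def)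
  have le: "w \<nu> x \<le> w \<nu>1 x1" using p(2)[OF S1] by (simp add: \<nu>_def x_def)
  then have wneg: "w \<nu> x < 0" using 1 by simp
  have "x $ k \<noteq> \<nu>"
  proof
    assume "x $ k = \<nu>"
    then have "reflect k \<nu> x = x" by (simp add: vec_eq_iff)
    then show False using wneg by (simp add: w_def)
  qed
  with xk have xk: "x $ k < \<nu>" by simp
  have "w \<nu> x \<le> w \<nu>' y" if y: "\<nu>' \<le> \<nu>" "y $ k < \<nu>'" for \<nu>' y
  proof (cases "norm y \<le> R'")
    case True
    then have "(\<nu>', y) \<in> S" using y \<nu> by (simp add: S_def)
    then show ?thesis using p(2) by (fastforce simp: \<nu>_def x_def)
  next
    case False
    show ?thesis
    proof (cases "y \<in> \<Omega>")
      case True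
      then have "u y < - w \<nu>1 x1" using False y \<nu> \<mu> by (intro R) (auto simp: R'_def)
      then show ?thesis using le u_nonneg[of "reflect k \<nu>' y"] unfolding w_def[of \<nu>' y] by linarith
    next
      case False
      then show ?thesis using w_neg_imp_mem[of \<nu>' y] wneg by force
    qed
  qed
  then have "critical \<nu> x"
    unfolding critical_def using \<nu> \<mu> xk wneg w_neg_imp_mem[OF wneg] by auto
  then show thesis using that \<nu> wneg by blast
qed

text \<open>Far out, the Lipschitz constant is smaller than the distance bound demands.\<close>

lemma critical_bounded:
  obtains R where "0 < R" "\<And>\<mu> x. critical \<mu> x \<Longrightarrow> w \<mu> x < 0 \<Longrightarrow> norm x < R"
proof -
  from small_lipschitz obtain R where R: "\<And>x. x \<in> \<Omega> \<Longrightarrow> x $ k < 0 \<Longrightarrow> R \<le> norm x \<Longrightarrow>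
       \<exists>D < 2 * c0 * norm x powr (- 2 * s). \<forall>v p. 0 < v \<and> v < u x \<longrightarrow> \<bar>f x v p - f x (u x) p\<bar> \<le> D * \<bar>v - u x\<bar>"
    by blast
  have "norm x < max R 1" if crit: "critical \<mu> x" and neg: "w \<mu> x < 0" for \<mu> x
  proof (rule ccontr)
    assume "\<not> norm x < max R 1"
    then have "R \<le> norm x" by auto
    from crit have x: "\<mu> \<le> 0" "x \<in> \<Omega>" "x $ k < \<mu>" by (auto simp: critical_def)
    obtain D where D: "D < 2 * c0 * norm x powr (- 2 * s)"
      "\<And>v p. 0 < v \<Longrightarrow> v < u x \<Longrightarrow> \<bar>f x v p - f x (u x) p\<bar> \<le> D * \<bar>v - u x\<bar>"
      using R[OF x(2) _ \<open>R \<le> norm x\<close>] x by auto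
    have "0 < u (reflect k \<mu> x)" "u (reflect k \<mu> x) < u x"
      using positive[OF reflect_mem[OF x(2,3,1)]] neg by (auto simp: w_def)
    from D(2)[OF this] have "2 * c0 * (\<mu> - x $ k) powr (- 2 * s) \<le> D"
      by (intro critical_distance_bound[OF crit _ neg]) (simp add: w_def)
    moreover have "norm x powr (- 2 * s) \<le> (\<mu> - x $ k) powr (- 2 * s)"
      using x s component_le_norm_cart[of x k] by (intro powr_mono2') auto
    then have "2 * c0 * norm x powr (- 2 * s) \<le> 2 * c0 * (\<mu> - x $ k) powr (- 2 * s)"
      using c0_pos by (intro mult_left_mono) auto
    ultimately show False using D(1) by linarith
  qed
  then show thesis by (intro that[of "max R 1"]) auto
qed

text \<open>Points left of the plane at \<open>- R\<close> have norm above \<open>R\<close>, where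
  negative critical points do not occur.\<close>

lemma ex_nonneg_upto: "\<exists>\<mu>\<le>0. nonneg_upto \<mu>"
proof -
  obtain R where R: "0 < R" "\<And>\<mu> x. critical \<mu> x \<Longrightarrow> w \<mu> x < 0 \<Longrightarrow> norm x < R"
    using critical_bounded by metis
  have "nonneg_upto (- R)"
  proof (rule ccontr)
    assume "\<not> nonneg_upto (- R)"
    then obtain \<nu> x where *: "\<nu> \<le> - R" "critical \<nu> x" "w \<nu> x < 0"
      using ex_critical[of "- R"] R(1) by auto
    then have "x $ k < - R" by (auto simp: critical_def)
    then show False using R(2)[OF *(2,3)] component_le_norm_cart[of x k] by linarith
  qed
  then show ?thesis using R(1) by (intro exI[of _ "- R"]) auto
qed

text \<open>Joint continuity in plane and point: positivity persists, with one lower bound, on a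
  ball and for all nearby planes.\<close>

lemma w_pos_near:
  assumes z: "z $ k < \<mu>" and pos: "0 < w \<mu> z"
  obtains \<rho> m where "0 < \<rho>" "0 < m" "z $ k + 2 * \<rho> \<le> \<mu>"
    "\<And>\<nu> y. \<bar>\<nu> - \<mu>\<bar> < \<rho> \<Longrightarrow> y \<in> ball z \<rho> \<Longrightarrow> m \<le> w \<nu> y"
proof -
  have "isCont (\<lambda>p. w (fst p) (snd p)) (\<mu>, z)"
    using cont_w[of UNIV] by (simp add: continuous_on_eq_continuous_at)
  then obtain d where d: "0 < d"
    "\<And>p. dist p (\<mu>, z) < d \<Longrightarrow> dist (w (fst p) (snd p)) (w \<mu> z) < w \<mu> z / 2"
    using pos unfolding continuous_at_eps_delta by (metis fst_conv half_gt_zero snd_conv)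
  \<comment> \<open>Half of \<open>d\<close> for the plane and half for the point; the second entry
    leaves a gap of \<open>\<rho>\<close> between the ball and the plane.\<close>
  define \<rho> where "\<rho> = min (d / 2) ((\<mu> - z $ k) / 2)"
  show thesis
  proof (rule that[of \<rho> "w \<mu> z / 2"])
    show "0 < \<rho>" using d z by (simp add: \<rho>_def)
    have "\<rho> \<le> (\<mu> - z $ k) / 2" unfolding \<rho>_def by (rule min.cobounded2)
    then show "z $ k + 2 * \<rho> \<le> \<mu>" by (simp add: field_simps)
    fix \<nu> y assume *: "\<bar>\<nu> - \<mu>\<bar> < \<rho>" "y \<in> ball z \<rho>"
    have "dist (\<nu>, y) (\<mu>, z) \<le> \<bar>\<nu> - \<mu>\<bar> + dist y z"
      unfolding dist_Pair_Pair dist_real_def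
      by (rule order_trans[OF sqrt_sum_squares_le_sum_abs]) simp
    also have "\<dots> < \<rho> + \<rho>" using * by (intro add_strict_mono) (auto simp: dist_commute)
    also have "\<dots> \<le> d" by (auto simp: \<rho>_def min_def)
    finally have "dist (w \<nu> y) (w \<mu> z) < w \<mu> z / 2" using d(2)[of "(\<nu>, y)"] by simp
    then show "w \<mu> z / 2 \<le> w \<nu> y" unfolding dist_real_def abs_less_iff by linarith
  qed (use pos in auto)
qed

lemma norm_reflect_le: "norm (reflect k \<mu> y) \<le> 3 * norm y + 2 * \<bar>\<mu>\<bar>"
proof -
  have "norm (axis k (1::real)) = 1" by (simp add: norm_eq_sqrt_inner inner_axis_axis)
  then have "norm ((2 * (\<mu> - y $ k)) *\<^sub>R axis k (1::real)) = 2 * \<bar>\<mu> - y $ k\<bar>"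
    by (simp only: norm_scaleR abs_mult abs_numeral mult_1_right)
  then have "norm (reflect k \<mu> y) \<le> norm y + 2 * \<bar>\<mu> - y $ k\<bar>"
    unfolding reflect_conv_axis by (metis norm_triangle_ineq)
  then show ?thesis using component_le_norm_cart[of y k] by (smt (verit))
qed

lemma norm_reflect_diff_le:
  assumes "y \<in> ball z \<rho>" "norm x \<le> R"
  shows "norm (reflect k \<mu> y - x) \<le> 3 * norm z + 3 * \<rho> + 2 * \<bar>\<mu>\<bar> + R"
proof -
  have "norm y \<le> norm z + norm (y - z)" by norm
  then have "norm y \<le> norm z + \<rho>" using assms by (simp add: dist_norm norm_minus_commute)
  then show ?thesis
    using norm_reflect_le[of \<mu> y] norm_triangle_ineq4[of "reflect k \<mu> y" x] assms(2) by linarith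
qed

text \<open>A zero of \<open>w \<nu>\<close> in \<open>\<Omega>\<close> is critical, and the two
  values of \<open>f\<close> coincide there, so \<open>D = 0\<close> is allowed. Positivity of
  \<open>w \<nu>\<close> anywhere would make the lower bound positive.\<close>

lemma strong_maximum_principle:
  assumes \<mu>: "\<mu> \<le> 0" and nonneg: "nonneg_upto \<mu>" and \<nu>: "\<nu> \<le> \<mu>"
    and x: "x \<in> \<Omega>" "x $ k < \<nu>" "w \<nu> x = 0" and z: "z $ k < \<nu>"
  shows "w \<nu> z = 0"
proof (rule ccontr)
  assume "w \<nu> z \<noteq> 0"
  then have "0 < w \<nu> z" using nonneg \<nu> z by (force simp: nonneg_upto_def less_le)
  then obtain \<rho> m where \<rho>: "0 < \<rho>" "0 < m" "z $ k + 2 * \<rho> \<le> \<nu>"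
    "\<And>\<nu>' y. \<bar>\<nu>' - \<nu>\<bar> < \<rho> \<Longrightarrow> y \<in> ball z \<rho> \<Longrightarrow> m \<le> w \<nu>' y"
    using w_pos_near[OF z] by metis
  define P where "P = 3 * norm z + 3 * \<rho> + 2 * \<bar>\<nu>\<bar> + norm x"
  have P: "0 < P" using \<rho>(1) norm_ge_zero[of z] norm_ge_zero[of x] unfolding P_def by linarith
  have "critical \<nu> x"
    unfolding critical_def using \<mu> \<nu> x nonneg by (auto simp: nonneg_upto_def)
  then have "m * (4 * (\<nu> - x $ k) * \<rho> / \<Theta>\<^sup>2 / (P / \<theta>) powr (q + 2)) * measure lborel (ball z \<rho>) \<le> 0 * \<bar>w \<nu> x\<bar>"
  proof (rule critical_positivity_bound)
    fix y assume y: "y \<in> ball z \<rho>"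
    have "\<bar>(y - z) $ k\<bar> \<le> norm (y - z)" by (rule component_le_norm_cart)
    then have "y $ k \<le> z $ k + \<rho>" using y by (simp add: dist_norm norm_minus_commute)
    then show "\<rho> \<le> \<nu> - y $ k \<and> m \<le> w \<nu> y \<and> norm (reflect k \<nu> y - x) \<le> P"
      using \<rho> y norm_reflect_diff_le[OF y, of x "norm x" \<nu>] by (simp add: P_def)
  qed (use \<rho> x in \<open>auto simp: w_def\<close>)
  moreover have "0 < m * (4 * (\<nu> - x $ k) * \<rho> / \<Theta>\<^sup>2 / (P / \<theta>) powr (q + 2)) * measure lborel (ball z \<rho>)"
    using \<rho> x \<theta> P by (intro mult_pos_pos divide_pos_pos) (auto simp: content_ball_pos)
  ultimately show False by simp
qed

lemma local_lipschitz:
  obtains D where "0 < D" "\<And>x v p. x \<in> \<Omega> \<Longrightarrow> norm x \<le> R \<Longrightarrow> 0 \<le> v \<Longrightarrow> v \<le> u x \<Longrightarrow>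
      \<bar>f x v p - f x (u x) p\<bar> \<le> D * \<bar>v - u x\<bar>"
proof -
  have "bounded (u ` cball 0 R)"
    by (intro compact_imp_bounded compact_continuous_image continuous_on_subset[OF cont_u]) auto
  then obtain M where M: "0 < M" "\<And>x. x \<in> cball 0 R \<Longrightarrow> \<bar>u x\<bar> \<le> M"
    unfolding bounded_pos by auto
  define K where "K = cball 0 R \<inter> closure \<Omega>"
  have K: "compact K \<and> K \<subseteq> closure \<Omega>"
    unfolding K_def by (simp add: compact_Int_closed)
  from f_class have "\<forall>M>0. \<forall>K. compact K \<and> K \<subseteq> closure \<Omega> \<longrightarrow> (\<exists>C>0. \<forall>u1\<in>{- M..M}. \<forall>u2\<in>{- M..M}.
      \<forall>x\<in>K \<inter> \<Omega>. \<forall>p. \<bar>f x u1 p - f x u2 p\<bar> \<le> C * \<bar>u1 - u2\<bar>)"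
    unfolding nonlin_class_def by simp
  from this[rule_format, OF M(1) K] obtain D where D: "0 < D" "\<forall>u1\<in>{- M..M}. \<forall>u2\<in>{- M..M}.
      \<forall>x\<in>K \<inter> \<Omega>. \<forall>p. \<bar>f x u1 p - f x u2 p\<bar> \<le> D * \<bar>u1 - u2\<bar>"
    by blast
  show thesis
  proof (rule that[OF D(1)])
    fix x v p assume *: "x \<in> \<Omega>" "norm x \<le> R" "0 \<le> v" "v \<le> u x"
    have "\<bar>u x\<bar> \<le> M" using * by (intro M(2)) simp
    then have "u x \<le> M" by simp
    then show "\<bar>f x v p - f x (u x) p\<bar> \<le> D * \<bar>v - u x\<bar>"
      using * \<open>u x \<le> M\<close> closure_subset[of \<Omega>]
      by (intro D(2)[rule_format]) (auto simp: K_def)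
  qed
qed

text \<open>Failure just right of \<open>\<mu>\<close> would give a negative critical point of
  bounded norm, at distance at least \<open>d0\<close> from its plane and hence left of the plane at
  \<open>\<mu>\<close>. There \<open>w\<close> is close to a nonnegative value, thus barely
  negative, against the positivity bound.\<close>

lemma nonneg_upto_extend:
  assumes \<mu>: "\<mu> < 0" and nonneg: "nonneg_upto \<mu>" and z: "z $ k < \<mu>" "w \<mu> z \<noteq> 0"
  shows "\<exists>\<eta>>0. \<mu> + \<eta> \<le> 0 \<and> nonneg_upto (\<mu> + \<eta>)"
proof -
  obtain R where R: "0 < R" "\<And>\<mu> x. critical \<mu> x \<Longrightarrow> w \<mu> x < 0 \<Longrightarrow> norm x < R"
    using critical_bounded by metis
  obtain D where D: "0 < D" "\<And>x v p. x \<in> \<Omega> \<Longrightarrow> norm x \<le> R \<Longrightarrow> 0 \<le> v \<Longrightarrow> v \<le> u x \<Longrightarrow>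
      \<bar>f x v p - f x (u x) p\<bar> \<le> D * \<bar>v - u x\<bar>"
    using local_lipschitz[of R] by metis
  have "0 < w \<mu> z" using nonneg z by (force simp: nonneg_upto_def less_le)
  then obtain \<rho> m where \<rho>: "0 < \<rho>" "0 < m" "z $ k + 2 * \<rho> \<le> \<mu>"
    "\<And>\<nu> y. \<bar>\<nu> - \<mu>\<bar> < \<rho> \<Longrightarrow> y \<in> ball z \<rho> \<Longrightarrow> m \<le> w \<nu> y"
    using w_pos_near[OF z(1)] by metis
  \<comment> \<open>The solution of \<open>2 * c0 * d0 powr (- 2 * s) = D\<close>.\<close>
  define d0 where "d0 = (D / (2 * c0)) powr (- 1 / (2 * s))"
  have d0: "0 < d0" using D(1) c0_pos by (simp add: d0_def)
  define P where "P = 3 * norm z + 3 * \<rho> + 2 * \<bar>\<mu>\<bar> + R"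
  have P: "0 < P" using \<rho>(1) R(1) norm_ge_zero[of z] unfolding P_def by linarith
  \<comment> \<open>The positivity bound with \<open>d0\<close> in place of the distance to the
    plane.\<close>
  define \<kappa> where "\<kappa> = m * (4 * d0 * \<rho> / \<Theta>\<^sup>2 / (P / \<theta>) powr (q + 2)) * measure lborel (ball z \<rho>)"
  have \<kappa>: "0 < \<kappa>"
    unfolding \<kappa>_def using \<rho> d0 \<theta> P by (intro mult_pos_pos divide_pos_pos) (auto simp: content_ball_pos)
  define \<epsilon> where "\<epsilon> = \<kappa> / (2 * D)"
  have \<epsilon>: "0 < \<epsilon>" using \<kappa> D(1) by (simp add: \<epsilon>_def)
  have "uniformly_continuous_on ({\<mu> - 1..\<mu> + 1} \<times> cball 0 R) (\<lambda>p. w (fst p) (snd p))"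
    by (intro compact_uniformly_continuous cont_w compact_Times) auto
  then obtain \<eta>1 where \<eta>1: "0 < \<eta>1" "\<And>p p'. p \<in> {\<mu> - 1..\<mu> + 1} \<times> cball 0 R \<Longrightarrow> p' \<in> {\<mu> - 1..\<mu> + 1} \<times> cball 0 R \<Longrightarrow>
      dist p' p < \<eta>1 \<Longrightarrow> dist (w (fst p') (snd p')) (w (fst p) (snd p)) < \<epsilon>"
    using \<epsilon> unfolding uniformly_continuous_on_def by metis
  \<comment> \<open>In order: positivity on the ball persists, uniform continuity applies,
    \<open>x\<close> stays left of the old plane, the new plane is at most 0, and both planes lie in
    the compact range.\<close>
  define \<eta> where "\<eta> = Min {\<rho> / 2, \<eta>1 / 2, d0 / 2, - \<mu>, 1}"
  have \<eta>: "0 < \<eta>" "\<eta> < \<rho>" "\<eta> < \<eta>1" "\<eta> < d0" "\<eta> \<le> - \<mu>" "\<eta> \<le> 1"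
    using \<rho>(1) \<eta>1(1) d0 \<mu> unfolding \<eta>_def by (auto simp: min_def)
  have "nonneg_upto (\<mu> + \<eta>)"
  proof (rule ccontr)
    assume "\<not> nonneg_upto (\<mu> + \<eta>)"
    then obtain \<nu> x where \<nu>: "\<nu> \<le> \<mu> + \<eta>" and crit: "critical \<nu> x" and neg: "w \<nu> x < 0"
      using ex_critical[of "\<mu> + \<eta>"] \<eta> by auto
    from crit have x: "\<nu> \<le> 0" "x \<in> \<Omega>" "x $ k < \<nu>" by (auto simp: critical_def)
    have xR: "norm x \<le> R" using R(2)[OF crit neg] by simp
    have \<nu>\<mu>: "\<mu> < \<nu>" using nonneg neg x(3) unfolding nonneg_upto_def by (meson not_le)
    have lip: "\<bar>f x (u (reflect k \<nu> x)) (grad u x) - f x (u x) (grad u x)\<bar> \<le> D * \<bar>w \<nu> x\<bar>"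
      using D(2)[OF x(2) xR u_nonneg, of "reflect k \<nu> x" "grad u x"] neg by (simp add: w_def)
    have d: "d0 \<le> \<nu> - x $ k"
    proof (rule ccontr)
      assume "\<not> d0 \<le> \<nu> - x $ k"
      then have "d0 powr (- 2 * s) < (\<nu> - x $ k) powr (- 2 * s)"
        using x s by (intro powr_less_mono2_neg) auto
      moreover have "d0 powr (- 2 * s) = D / (2 * c0)"
        using s D(1) c0_pos by (simp add: d0_def powr_powr)
      ultimately have "D / (2 * c0) < (\<nu> - x $ k) powr (- 2 * s)" by simp
      then have "D < 2 * c0 * (\<nu> - x $ k) powr (- 2 * s)"
        using pos_divide_less_eq[of "2 * c0" D] c0_pos by (simp only: mult.commute)
      then show False using critical_distance_bound[OF crit lip neg] by linarith
    qed
    then have "x $ k < \<mu>" using \<nu> \<eta>(4) by linarith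
    then have "0 \<le> w \<mu> x" using nonneg by (simp add: nonneg_upto_def)
    moreover have "dist (w \<nu> x) (w \<mu> x) < \<epsilon>"
      using \<eta>1(2)[of "(\<mu>, x)" "(\<nu>, x)"] \<nu> \<nu>\<mu> \<eta> xR by (simp add: dist_Pair_Pair dist_real_def)
    ultimately have "\<bar>w \<nu> x\<bar> < \<epsilon>" using neg by (simp add: dist_real_def)
    then have "D * \<bar>w \<nu> x\<bar> < D * \<epsilon>" using D(1) by simp
    also have "\<dots> < \<kappa>" using D(1) \<kappa> by (simp add: \<epsilon>_def)
    finally have "D * \<bar>w \<nu> x\<bar> < \<kappa>" .
    moreover have "m * (4 * (\<nu> - x $ k) * \<rho> / \<Theta>\<^sup>2 / (P / \<theta>) powr (q + 2)) * measure lborel (ball z \<rho>) \<le> D * \<bar>w \<nu> x\<bar>"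
    proof (rule critical_positivity_bound[OF crit lip])
      fix y assume y: "y \<in> ball z \<rho>"
      have "\<bar>(y - z) $ k\<bar> \<le> norm (y - z)" by (rule component_le_norm_cart)
      then have "y $ k \<le> z $ k + \<rho>" using y by (simp add: dist_norm norm_minus_commute)
      moreover have "norm (reflect k \<nu> y - x) \<le> P"
        using norm_reflect_diff_le[OF y xR, of \<nu>] \<nu>\<mu> x(1) by (simp add: P_def)
      moreover have "m \<le> w \<nu> y" using \<nu> \<nu>\<mu> \<eta>(2) y by (intro \<rho>(4)) auto
      ultimately show "\<rho> \<le> \<nu> - y $ k \<and> m \<le> w \<nu> y \<and> norm (reflect k \<nu> y - x) \<le> P"
        using \<rho>(3) \<nu>\<mu> by simp
    qed (use \<rho> in auto)
    moreover have "\<kappa> \<le> m * (4 * (\<nu> - x $ k) * \<rho> / \<Theta>\<^sup>2 / (P / \<theta>) powr (q + 2)) * measure lborel (ball z \<rho>)"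
      unfolding \<kappa>_def using d \<rho> by (intro mult_right_mono mult_left_mono divide_right_mono) auto
    ultimately show False by linarith
  qed
  then show ?thesis using \<eta> by (intro exI[of _ \<eta>]) auto
qed

section \<open>Consequences of symmetry about a second plane\<close>

lemma translate_mem:
  assumes sym: "\<And>x. u (reflect k \<nu> x) = u x" and x: "x \<in> \<Omega>"
  shows "x + (real j * (2 * \<nu>)) *\<^sub>R axis k 1 \<in> \<Omega>"
proof (induction j)
  case (Suc j)
  let ?y = "x + (real j * (2 * \<nu>)) *\<^sub>R axis k 1"
  \<comment> \<open>Reflecting about 0 and then about \<open>\<nu>\<close> is translation by
    \<open>2 * \<nu>\<close>. The second reflection also preserves \<open>\<Omega>\<close>, the
    positivity set of \<open>u\<close>.\<close>
  have "reflect k 0 ?y \<in> \<Omega>" using Suc symmetric by blast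
  then have "reflect k \<nu> (reflect k 0 ?y) \<in> \<Omega>"
    using sym positive zero_outside by (metis less_irrefl)
  moreover have "reflect k \<nu> (reflect k 0 ?y) = x + (real (Suc j) * (2 * \<nu>)) *\<^sub>R axis k 1"
    by (simp add: vec_eq_iff axis_def algebra_simps)
  ultimately show ?case by simp
qed (use x in simp)

lemma translate_left_mem:
  assumes sym: "\<And>x. u (reflect k \<nu> x) = u x" and \<nu>: "\<nu> < 0" and x: "x \<in> \<Omega>"
  obtains y where "y \<in> \<Omega>" "y $ k < t" "\<And>i. i \<noteq> k \<Longrightarrow> y $ i = x $ i"
proof -
  obtain j :: nat where "(t - x $ k) / (2 * \<nu>) < real j"
    using reals_Archimedean2 by blast
  then have "x $ k + real j * (2 * \<nu>) < t" using \<nu> by (simp add: field_simps)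
  then show thesis
    by (intro that[OF translate_mem[OF sym x, of j]]) (auto simp: axis_def)
qed

text \<open>Antisymmetry of \<open>w\<close> carries the equality across the plane.\<close>

lemma symmetric_everywhere:
  assumes "\<And>x. x $ k < \<nu> \<Longrightarrow> w \<nu> x = 0"
  shows "u (reflect k \<nu> x) = u x"
proof -
  have "w \<nu> x = 0"
  proof (cases "x $ k" \<nu> rule: linorder_cases)
    case greater
    then have "w \<nu> (reflect k \<nu> x) = 0" by (intro assms) simp
    then show ?thesis by (simp add: w_reflect)
  next
    case equal
    then have "reflect k \<nu> x = x" by (simp add: vec_eq_iff)
    then show ?thesis by (simp add: w_def)
  qed (rule assms)
  then show ?thesis by (simp add: w_def)
qed

text \<open>
  Symmetry about a plane strictly left of \<open>\<mu>\<close> together with monotonicity up to \<open>\<mu>\<close> makes \<open>u\<close>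
  periodic to the left, which the decay at infinity forbids.
\<close>

lemma not_symmetric_before:
  assumes \<mu>: "\<mu> \<le> 0" and nonneg: "nonneg_upto \<mu>" and \<nu>: "\<nu> < \<mu>" and ne: "\<Omega> \<noteq> {}"
    and zero: "\<And>x. x $ k < \<nu> \<Longrightarrow> w \<nu> x = 0"
  shows False
proof -
  note sym = symmetric_everywhere[OF zero]
  \<comment> \<open>The reflections about \<open>\<nu>\<close> and then \<open>\<mu>\<close> compose
    to translation by \<open>\<tau>\<close>.\<close>
  define \<tau> where "\<tau> = 2 * (\<mu> - \<nu>)"
  have \<tau>: "0 < \<tau>" using \<nu> by (simp add: \<tau>_def)
  obtain x where x: "x \<in> \<Omega>" "x $ k < 2 * \<nu> - \<mu>"
    using ne translate_left_mem[OF sym, of _ "2 * \<nu> - \<mu>"] \<nu> \<mu> by (metis all_not_in_conv less_le_trans)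
  \<comment> \<open>The plane midway between \<open>y\<close> and its translate gives one
    inequality. For the other, reflecting the translate about \<open>\<mu>\<close> gives the
    reflection of \<open>y\<close> about \<open>\<nu>\<close>, where \<open>u\<close> has the value
    \<open>u y\<close>; the bound on \<open>y $ k\<close> keeps the translate left of
    \<open>\<mu>\<close>.\<close>
  have step: "u y = u (y + \<tau> *\<^sub>R axis k 1)" if y: "y $ k < 2 * \<nu> - \<mu>" for y
  proof (rule antisym)
    let ?y' = "y + \<tau> *\<^sub>R axis k 1"
    have "0 \<le> w (y $ k + (\<mu> - \<nu>)) y"
      using nonneg y \<nu> by (auto simp: nonneg_upto_def)
    moreover have "reflect k (y $ k + (\<mu> - \<nu>)) y = ?y'"
      by (simp add: vec_eq_iff axis_def \<tau>_def)
    ultimately show "u y \<le> u ?y'" by (simp add: w_def)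
    have "0 \<le> w \<mu> ?y'"
      using nonneg y by (auto simp: nonneg_upto_def \<tau>_def)
    moreover have "reflect k \<mu> ?y' = reflect k \<nu> y"
      by (simp add: vec_eq_iff axis_def \<tau>_def)
    ultimately show "u ?y' \<le> u y" by (simp add: w_def sym)
  qed
  let ?x = "\<lambda>j. x - (real j * \<tau>) *\<^sub>R axis k 1"
  have const: "u (?x j) = u x" for j
  proof (induction j)
    case (Suc j)
    have "0 \<le> real (Suc j) * \<tau>" using \<tau> by simp
    then have "?x (Suc j) $ k < 2 * \<nu> - \<mu>" using x by (simp only: vector_minus_component vector_scaleR_component) (simp add: axis_def)
    then have "u (?x (Suc j)) = u (?x (Suc j) + \<tau> *\<^sub>R axis k 1)" by (rule step)
    also have "?x (Suc j) + \<tau> *\<^sub>R axis k 1 = ?x j"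
      by (simp add: vec_eq_iff algebra_simps)
    finally show ?case using Suc by simp
  qed simp
  obtain R where R: "\<And>y. y \<in> \<Omega> \<Longrightarrow> y $ k < 0 \<Longrightarrow> R \<le> norm y \<Longrightarrow> u y < u x"
    using decay[OF positive[OF x(1)]] by blast
  obtain j :: nat where "\<bar>R\<bar> / \<tau> < real j" using reals_Archimedean2 by blast
  then have j: "\<bar>R\<bar> < real j * \<tau>" using \<tau> by (simp add: field_simps)
  have k: "?x j $ k = x $ k - real j * \<tau>" by (simp add: axis_def)
  have "?x j \<in> \<Omega>" using const[of j] positive[OF x(1)] zero_outside[of "?x j"] by force
  moreover have "?x j $ k < 0" "R \<le> norm (?x j)"
    using k j x \<nu> \<mu> component_le_norm_cart[of "?x j" k] by linarith+
  ultimately show False using R const[of j] by force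
qed

text \<open>Take the plane midway between the two points. A zero of \<open>w \<nu>\<close> at
  \<open>x\<close> would spread, by the strong maximum principle, to symmetry about a plane strictly
  left of \<open>\<mu>\<close>.\<close>

lemma strict_incr:
  assumes \<mu>: "\<mu> \<le> 0" and nonneg: "nonneg_upto \<mu>"
  shows "strict_incr_in_dir k (\<Omega> \<inter> {x. x $ k < \<mu>}) u"
  unfolding strict_incr_in_dir_def
proof (intro ballI impI)
  fix x y assume x: "x \<in> \<Omega> \<inter> {x. x $ k < \<mu>}" and y: "y \<in> \<Omega> \<inter> {x. x $ k < \<mu>}"
    and *: "(\<forall>i. i \<noteq> k \<longrightarrow> x $ i = y $ i) \<and> x $ k < y $ k"
  define \<nu> where "\<nu> = (x $ k + y $ k) / 2"
  have \<nu>: "x $ k < \<nu>" "\<nu> < \<mu>" using x y * by (auto simp: \<nu>_def)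
  have r: "reflect k \<nu> x = y" using * by (auto simp: vec_eq_iff \<nu>_def field_simps)
  have "w \<nu> x \<noteq> 0"
  proof
    assume "w \<nu> x = 0"
    then have "w \<nu> z = 0" if "z $ k < \<nu>" for z
      using strong_maximum_principle[OF \<mu> nonneg, of \<nu> x z] \<nu> x that by auto
    then show False using not_symmetric_before[OF \<mu> nonneg \<nu>(2)] x by blast
  qed
  moreover have "0 \<le> w \<nu> x" using nonneg \<nu> by (simp add: nonneg_upto_def)
  ultimately show "u x < u y" by (simp add: w_def r)
qed

text \<open>The supremum of the planes that can be reached. Nonnegativity passes to it by continuity
  from the left, and if it is negative with \<open>w \<mu>\<close> not identically 0, the plane
  could be moved further.\<close>

lemma ex_limiting_plane:
  obtains \<mu> where "\<mu> \<le> 0" "nonneg_upto \<mu>" "\<mu> < 0 \<Longrightarrow> \<forall>x. x $ k < \<mu> \<longrightarrow> w \<mu> x = 0"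
proof -
  define G where "G = {\<mu>. \<mu> \<le> 0 \<and> nonneg_upto \<mu>}"
  define \<mu> where "\<mu> = Sup G"
  have ne: "G \<noteq> {}" using ex_nonneg_upto by (auto simp: G_def)
  have bdd: "bdd_above G" by (auto simp: G_def bdd_above_def)
  have \<mu>: "\<mu> \<le> 0" unfolding \<mu>_def using ne by (rule cSup_least) (auto simp: G_def)
  have below: "0 \<le> w \<nu> x" if "\<nu> < \<mu>" "x $ k < \<nu>" for \<nu> x
  proof -
    obtain \<mu>' where "\<mu>' \<in> G" "\<nu> < \<mu>'" using less_cSupD[OF ne] \<open>\<nu> < \<mu>\<close> unfolding \<mu>_def by blast
    then show ?thesis using that by (auto simp: G_def nonneg_upto_def)
  qed
  have nonneg: "nonneg_upto \<mu>"
    unfolding nonneg_upto_def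
  proof (intro allI impI)
    fix \<nu> x assume \<nu>: "\<nu> \<le> \<mu>" "x $ k < \<nu>"
    show "0 \<le> w \<nu> x"
    proof (cases "\<nu> = \<mu>")
      case True
      have "isCont (\<lambda>t. w t x) \<mu>"
      proof -
        have "continuous_on UNIV (\<lambda>t. w t x)"
          unfolding w_def by (intro continuous_intros continuous_on_compose2[OF cont_u]) auto
        then show ?thesis by (simp add: continuous_on_eq_continuous_at)
      qed
      then have "((\<lambda>t. w t x) \<longlongrightarrow> w \<mu> x) (at_left \<mu>)"
        by (simp add: isCont_def filterlim_at_split)
      moreover have "eventually (\<lambda>t. t \<in> {x $ k<..<\<mu>}) (at_left \<mu>)"
        using \<nu> True by (intro eventually_at_left_real) simp
      then have "eventually (\<lambda>t. 0 \<le> w t x) (at_left \<mu>)"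
        by eventually_elim (auto intro: below)
      ultimately show ?thesis
        unfolding True by (rule tendsto_lowerbound) simp
    qed (use \<nu> below in auto)
  qed
  show thesis
  proof (rule that[OF \<mu> nonneg])
    assume "\<mu> < 0"
    show "\<forall>x. x $ k < \<mu> \<longrightarrow> w \<mu> x = 0"
    proof (rule ccontr)
      assume "\<not> (\<forall>x. x $ k < \<mu> \<longrightarrow> w \<mu> x = 0)"
      then obtain \<eta> where "0 < \<eta>" "\<mu> + \<eta> \<in> G"
        using nonneg_upto_extend[OF \<open>\<mu> < 0\<close> nonneg] by (auto simp: G_def)
      then show False using cSup_upper[OF _ bdd, of "\<mu> + \<eta>"] by (simp add: \<mu>_def)
    qed
  qed
qed

text \<open>Symmetry about \<open>\<nu>\<close> shifts a point of \<open>L\<close> in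
  \<open>\<Omega>\<close> as far left as desired; the segment to its mirror image about 0 then
  covers \<open>b\<close>.\<close>

lemma line_not_crossing:
  assumes \<nu>: "\<nu> < 0" and zero: "\<And>x. x $ k < \<nu> \<Longrightarrow> w \<nu> x = 0"
    and L: "line_in_dir k L" "L \<inter> \<Omega> \<noteq> {}"
  shows "L \<subseteq> \<Omega>"
proof
  fix b assume b: "b \<in> L"
  obtain a where a: "a \<in> L" "a \<in> \<Omega>" using L by blast
  from L(1) obtain c where "L = range (\<lambda>t. c + t *\<^sub>R axis k 1)" by (auto simp: line_in_dir_def)
  then have ab: "a $ i = b $ i" if "i \<noteq> k" for i using a b that by (auto simp: axis_def)
  obtain y where y: "y \<in> \<Omega>" "y $ k < - \<bar>b $ k\<bar>" "\<And>i. i \<noteq> k \<Longrightarrow> y $ i = a $ i"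
    using translate_left_mem[OF symmetric_everywhere[OF zero] \<nu> a(2)] by metis
  have "set_coord k (b $ k) y \<in> \<Omega>" using y(1,2) by (intro set_coord_mem) auto
  moreover have "set_coord k (b $ k) y = b" using y(3) ab by (simp add: vec_eq_iff)
  ultimately show "b \<in> \<Omega>" by simp
qed

text \<open>One limiting plane serves both parts: at a negative position it would force every line
  meeting \<open>\<Omega>\<close> to lie in \<open>\<Omega>\<close>, so in the first part its
  position is 0.\<close>

lemma monotone_and_symmetric:
  "((\<exists>L. line_in_dir k L \<and> L \<inter> \<Omega> \<noteq> {} \<and> L \<inter> - \<Omega> \<noteq> {}) \<longrightarrow>
      strict_incr_in_dir k (\<Omega> \<inter> {x. x $ k < 0}) u \<and>
      (\<forall>x\<in>\<Omega>. x $ k < 0 \<longrightarrow> u x \<le> u (reflect k 0 x))) \<and>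
   ((\<forall>L. line_in_dir k L \<and> L \<inter> \<Omega> \<noteq> {} \<longrightarrow> L \<inter> - \<Omega> = {}) \<longrightarrow>
      (\<exists>\<mu>0\<le>0. strict_incr_in_dir k (\<Omega> \<inter> {x. x $ k < \<mu>0}) u \<and>
         (\<mu>0 = 0 \<longrightarrow> (\<forall>x\<in>\<Omega>. x $ k < 0 \<longrightarrow> u x \<le> u (reflect k 0 x))) \<and>
         (\<mu>0 < 0 \<longrightarrow> (\<forall>x\<in>\<Omega>. x $ k < \<mu>0 \<longrightarrow> u x = u (reflect k \<mu>0 x)))))"
proof -
  obtain \<mu> where \<mu>: "\<mu> \<le> 0" "nonneg_upto \<mu>" and sym: "\<mu> < 0 \<Longrightarrow> \<forall>x. x $ k < \<mu> \<longrightarrow> w \<mu> x = 0"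
    using ex_limiting_plane by blast
  have incr: "strict_incr_in_dir k (\<Omega> \<inter> {x. x $ k < \<mu>}) u"
    by (rule strict_incr[OF \<mu>])
  have zero: "\<forall>x\<in>\<Omega>. x $ k < 0 \<longrightarrow> u x \<le> u (reflect k 0 x)" if "\<mu> = 0"
    using \<mu>(2) that unfolding nonneg_upto_def w_def by force
  have neg: "\<forall>x\<in>\<Omega>. x $ k < \<mu> \<longrightarrow> u x = u (reflect k \<mu> x)" if "\<mu> < 0"
    using sym[OF that] by (simp add: w_def)
  have "\<mu> = 0" if L: "line_in_dir k L" "L \<inter> \<Omega> \<noteq> {}" "L \<inter> - \<Omega> \<noteq> {}" for L
  proof (rule ccontr)
    assume "\<mu> \<noteq> 0"
    then have "\<mu> < 0" using \<mu>(1) by simp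
    then have "L \<subseteq> \<Omega>" using sym L by (intro line_not_crossing) auto
    then show False using L(3) by blast
  qed
  then show ?thesis using \<mu>(1) incr zero neg by blast
qed

end

section \<open>From the asymptotic hypotheses to the moving plane setting\<close>

theorem theorem3p5:
  fixes s \<theta> :: real
  assumes "CARD('n::finite) \<ge> 2" and "0 < s" and "s < 1" and "0 < \<theta>"
  shows "\<exists>C0>0. \<forall>(\<Theta>::real) (k::'n) (\<Omega>::(real ^ 'n) set)
           (f::real ^ 'n \<Rightarrow> real \<Rightarrow> real ^ 'n \<Rightarrow> real) (u::real ^ 'n \<Rightarrow> real) (\<beta>::real) (C::real).
     \<theta> \<le> \<Theta> \<longrightarrow>
     open \<Omega> \<longrightarrow> connected \<Omega> \<longrightarrow> \<not> bounded \<Omega> \<longrightarrow>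
     convex_in_dir k \<Omega> \<longrightarrow> reflect k 0 ` \<Omega> = \<Omega> \<longrightarrow>
     f \<in> nonlin_class \<Omega> \<longrightarrow>
     u \<in> C11_loc \<Omega> \<longrightarrow> continuous_on (closure \<Omega>) u \<longrightarrow> u \<in> L_space s \<longrightarrow>
     (\<forall>x\<in>\<Omega>. - Fs s \<theta> \<Theta> (axis k 1) u x = f x (u x) (grad u x)) \<longrightarrow>
     (\<forall>x\<in>\<Omega>. u x > 0) \<longrightarrow>
     (\<forall>x\<in>- \<Omega>. u x = 0) \<longrightarrow>
     (\<forall>x\<in>\<Omega>. \<forall>v p t. x $ k \<le> 0 \<and> p $ k \<ge> 0 \<and> x $ k \<le> t \<and> t \<le> - (x $ k) \<longrightarrow>
        f x v p \<le> f (set_coord k t x) v (set_coord k (- (p $ k)) p)) \<longrightarrow>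
     \<beta> > 0 \<longrightarrow> C > 0 \<longrightarrow>
     (\<exists>\<delta>>0. \<forall>x\<in>\<Omega>. \<forall>p u1 u2. \<bar>u1\<bar> < \<delta> \<and> \<bar>u2\<bar> < \<delta> \<and> u1 \<noteq> u2 \<longrightarrow>
        \<bar>f x u1 p - f x u2 p\<bar> / \<bar>u1 - u2\<bar> \<le> C * (\<bar>u1\<bar> powr \<beta> + \<bar>u2\<bar> powr \<beta>)) \<longrightarrow>
     Limsup (inf at_infinity (principal {x \<in> \<Omega>. x $ k < 0}))
        (\<lambda>x. ereal (norm x powr (2 * s) * u x powr \<beta>)) < ereal (C0 / (8 * C)) \<longrightarrow>
     ((\<exists>L. line_in_dir k L \<and> L \<inter> \<Omega> \<noteq> {} \<and> L \<inter> - \<Omega> \<noteq> {}) \<longrightarrow>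
        strict_incr_in_dir k (\<Omega> \<inter> {x. x $ k < 0}) u \<and>
        (\<forall>x\<in>\<Omega>. x $ k < 0 \<longrightarrow> u x \<le> u (reflect k 0 x))) \<and>
     ((\<forall>L. line_in_dir k L \<and> L \<inter> \<Omega> \<noteq> {} \<longrightarrow> L \<inter> - \<Omega> = {}) \<longrightarrow>
        (\<exists>\<mu>0\<le>0. strict_incr_in_dir k (\<Omega> \<inter> {x. x $ k < \<mu>0}) u \<and>
           (\<mu>0 = 0 \<longrightarrow> (\<forall>x\<in>\<Omega>. x $ k < 0 \<longrightarrow> u x \<le> u (reflect k 0 x))) \<and>
           (\<mu>0 < 0 \<longrightarrow> (\<forall>x\<in>\<Omega>. x $ k < \<mu>0 \<longrightarrow> u x = u (reflect k \<mu>0 x)))))"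
proof -
  define q where "q = real CARD('n) + 2 * s"
  \<comment> \<open>The constant of the theorem is \<open>8 * c0\<close>, so the limit superior
    condition bounds \<open>norm x powr (2 * s) * u x powr \<beta>\<close> by \<open>c0 / C\<close>
    far out.\<close>
  define c0 where "c0 = (3 / \<theta>) powr (- q) * unit_ball_vol (real CARD('n))"
  have c0: "0 < c0" using assms by (simp add: c0_def)
  then have pos: "0 < 8 * c0" by simp
  show ?thesis
  proof (rule exI[of _ "8 * c0"], intro conjI[OF pos] allI impI)
    fix \<Theta> \<beta> C :: real and k :: 'n and \<Omega> :: "(real^'n) set"
      and f :: "real^'n \<Rightarrow> real \<Rightarrow> real^'n \<Rightarrow> real" and u :: "real^'n \<Rightarrow> real"
    assume \<Theta>: "\<theta> \<le> \<Theta>" and \<Omega>: "open \<Omega>" "convex_in_dir k \<Omega>" "reflect k 0 ` \<Omega> = \<Omega>"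
      and f_class: "f \<in> nonlin_class \<Omega>" and u: "u \<in> C11_loc \<Omega>" "continuous_on (closure \<Omega>) u" "u \<in> L_space s"
      and eq: "\<forall>x\<in>\<Omega>. - Fs s \<theta> \<Theta> (axis k 1) u x = f x (u x) (grad u x)"
      and u_pos: "\<forall>x\<in>\<Omega>. u x > 0" and u_zero: "\<forall>x\<in>- \<Omega>. u x = 0"
      and f_mono: "\<forall>x\<in>\<Omega>. \<forall>v p t. x $ k \<le> 0 \<and> p $ k \<ge> 0 \<and> x $ k \<le> t \<and> t \<le> - (x $ k) \<longrightarrow>
        f x v p \<le> f (set_coord k t x) v (set_coord k (- (p $ k)) p)"
      and \<beta>: "\<beta> > 0" and C: "C > 0"
      and f_small: "\<exists>\<delta>>0. \<forall>x\<in>\<Omega>. \<forall>p u1 u2. \<bar>u1\<bar> < \<delta> \<and> \<bar>u2\<bar> < \<delta> \<and> u1 \<noteq> u2 \<longrightarrow>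
        \<bar>f x u1 p - f x u2 p\<bar> / \<bar>u1 - u2\<bar> \<le> C * (\<bar>u1\<bar> powr \<beta> + \<bar>u2\<bar> powr \<beta>)"
      and limsup: "Limsup (inf at_infinity (principal {x \<in> \<Omega>. x $ k < 0}))
        (\<lambda>x. ereal (norm x powr (2 * s) * u x powr \<beta>)) < ereal (8 * c0 / (8 * C))"
    define c where "c = c0 / C"
    have c: "0 < c" using c0 C by (simp add: c_def)
    have "eventually (\<lambda>x. ereal (norm x powr (2 * s) * u x powr \<beta>) < ereal c)
        (inf at_infinity (principal {x \<in> \<Omega>. x $ k < 0}))"
      using limsup by (intro Limsup_lessD) (simp add: c_def)
    then obtain b where b: "\<And>x. x \<in> \<Omega> \<Longrightarrow> x $ k < 0 \<Longrightarrow> b \<le> norm x \<Longrightarrow> norm x powr (2 * s) * u x powr \<beta> < c"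
      unfolding eventually_inf_principal eventually_at_infinity by auto
    have decay: "\<exists>R. \<forall>x\<in>\<Omega>. x $ k < 0 \<and> R \<le> norm x \<longrightarrow> u x < \<epsilon>" if \<epsilon>: "0 < \<epsilon>" for \<epsilon>
    proof (intro exI ballI impI)
      \<comment> \<open>Beyond this radius
        \<open>norm x powr (2 * s) * \<epsilon> powr \<beta>\<close> is at least \<open>c\<close>,
        so \<open>u x \<ge> \<epsilon>\<close> would violate the asymptotic bound.\<close>
      fix x assume x: "x \<in> \<Omega>" "x $ k < 0 \<and> max b ((c / \<epsilon> powr \<beta>) powr (1 / (2 * s))) \<le> norm x"
      have "c / \<epsilon> powr \<beta> = ((c / \<epsilon> powr \<beta>) powr (1 / (2 * s))) powr (2 * s)"
        using assms c \<epsilon> by (simp add: powr_powr)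
      also have "\<dots> \<le> norm x powr (2 * s)"
        using assms x by (intro powr_mono2) auto
      finally have "c \<le> norm x powr (2 * s) * \<epsilon> powr \<beta>"
        using \<epsilon> by (simp add: divide_le_eq)
      moreover have "norm x powr (2 * s) * u x powr \<beta> < c"
        using x by (intro b) auto
      ultimately have "norm x powr (2 * s) * u x powr \<beta> < norm x powr (2 * s) * \<epsilon> powr \<beta>"
        by linarith
      then have "u x powr \<beta> < \<epsilon> powr \<beta>"
        by (rule mult_left_less_imp_less) simp
      then show "u x < \<epsilon>"
        using \<beta> \<epsilon> by (meson less_imp_le not_le powr_mono2)
    qed
    have small: "\<exists>R. \<forall>x\<in>\<Omega>. x $ k < 0 \<and> R \<le> norm x \<longrightarrow>
       (\<exists>D < 2 * c0 * norm x powr (- 2 * s). \<forall>v p. 0 < v \<and> v < u x \<longrightarrow> \<bar>f x v p - f x (u x) p\<bar> \<le> D * \<bar>v - u x\<bar>)"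
    proof -
      obtain \<delta> where \<delta>: "0 < \<delta>" and lip: "\<And>x p u1 u2. x \<in> \<Omega> \<Longrightarrow> \<bar>u1\<bar> < \<delta> \<Longrightarrow> \<bar>u2\<bar> < \<delta> \<Longrightarrow> u1 \<noteq> u2 \<Longrightarrow>
        \<bar>f x u1 p - f x u2 p\<bar> / \<bar>u1 - u2\<bar> \<le> C * (\<bar>u1\<bar> powr \<beta> + \<bar>u2\<bar> powr \<beta>)"
        using f_small by blast
      obtain R where R: "\<And>x. x \<in> \<Omega> \<Longrightarrow> x $ k < 0 \<Longrightarrow> R \<le> norm x \<Longrightarrow> u x < \<delta>"
        using decay[OF \<delta>] by blast
      show ?thesis
      proof (rule exI[of _ "max (max b 1) R"], intro ballI impI)
        fix x assume x: "x \<in> \<Omega>" "x $ k < 0 \<and> max (max b 1) R \<le> norm x"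
        \<comment> \<open>Both \<open>v\<close> and \<open>u x\<close> contribute at most
          \<open>u x powr \<beta>\<close>, whence the 2; with \<open>c = c0 / C\<close> the
          asymptotic bound turns this into the required \<open>2 * c0\<close>.\<close>
        define D where "D = 2 * C * u x powr \<beta>"
        have "norm x powr (2 * s) * u x powr \<beta> < c" using x by (intro b) auto
        moreover have nx: "0 < norm x" using x by auto
        ultimately have "u x powr \<beta> < c * norm x powr (- 2 * s)"
          by (simp add: powr_minus_divide less_divide_eq mult.commute)
        then have "D < 2 * C * (c * norm x powr (- 2 * s))"
          unfolding D_def using C by (intro mult_strict_left_mono) auto
        then have D: "D < 2 * c0 * norm x powr (- 2 * s)"
          using C by (simp add: c_def)
        have "\<bar>f x v p - f x (u x) p\<bar> \<le> D * \<bar>v - u x\<bar>" if v: "0 < v \<and> v < u x" for v p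
        proof -
          have "u x < \<delta>" using x by (intro R) auto
          then have "\<bar>f x v p - f x (u x) p\<bar> / \<bar>v - u x\<bar> \<le> C * (\<bar>v\<bar> powr \<beta> + \<bar>u x\<bar> powr \<beta>)"
            using x v by (intro lip) auto
          also have "\<dots> \<le> C * (u x powr \<beta> + u x powr \<beta>)"
            using C v \<beta> by (intro mult_left_mono add_mono powr_mono2) auto
          finally show ?thesis using v by (simp add: D_def divide_le_eq)
        qed
        with D show "\<exists>D < 2 * c0 * norm x powr (- 2 * s). \<forall>v p. 0 < v \<and> v < u x \<longrightarrow>
            \<bar>f x v p - f x (u x) p\<bar> \<le> D * \<bar>v - u x\<bar>"
          by blast
      qed
    qed
    interpret moving_planes_decay s \<theta> \<Theta> k \<Omega> f u q c0
      by unfold_locales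
        (use assms \<Theta> \<Omega> f_class u eq u_pos u_zero f_mono q_def c0_def decay small in \<open>simp_all\<close>)
    show "((\<exists>L. line_in_dir k L \<and> L \<inter> \<Omega> \<noteq> {} \<and> L \<inter> - \<Omega> \<noteq> {}) \<longrightarrow>
        strict_incr_in_dir k (\<Omega> \<inter> {x. x $ k < 0}) u \<and>
        (\<forall>x\<in>\<Omega>. x $ k < 0 \<longrightarrow> u x \<le> u (reflect k 0 x))) \<and>
     ((\<forall>L. line_in_dir k L \<and> L \<inter> \<Omega> \<noteq> {} \<longrightarrow> L \<inter> - \<Omega> = {}) \<longrightarrow>
        (\<exists>\<mu>0\<le>0. strict_incr_in_dir k (\<Omega> \<inter> {x. x $ k < \<mu>0}) u \<and>
           (\<mu>0 = 0 \<longrightarrow> (\<forall>x\<in>\<Omega>. x $ k < 0 \<longrightarrow> u x \<le> u (reflect k 0 x))) \<and>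
           (\<mu>0 < 0 \<longrightarrow> (\<forall>x\<in>\<Omega>. x $ k < \<mu>0 \<longrightarrow> u x = u (reflect k \<mu>0 x)))))"
      by (rule monotone_and_symmetric)
  qed
qed

end
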